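(* Let $A=\begin{pmatrix}A_{11}&A_{12}\\ A_{21}&A_{22}\end{pmatrix}$ be a real symmetric positive definite $N\times N$ matrix, where $A_{11}$ is $m\times m$, $A_{22}$ is $n\times n$, $N=m+n$ and $A_{21}=A_{12}^T$. Let $A_{11}=L_1L_1^T$, $A_{22}=L_2L_2^T$ be Cholesky factorizations, and let $C=L_1^{-1}A_{12}L_2^{-T}$ with singular values $\sigma_1\ge\sigma_2\ge\cdots\ge\sigma_{k}$, $k=\min\{m,n\}$ (all of which are $<1$). Let $C=U\Sigma V^T$ be a full SVD, let $1\le r<k$, let $\Sigma_1=\operatorname{diag}(\sigma_1,\ldots,\sigma_r)$, let $V_1$ consist of the first $r$ columns of $V$, and let $\tau>0$ satisfy $\sigma_r\ge\tau\ge\sigma_{r+1}$. Let $\tilde D_2$ be the lower triangular Cholesky factor of $I-V_1\Sigma_1^2V_1^T$, i.e. $I-V_1\Sigma_1^2V_1^T=\tilde D_2\tilde D_2^T$, and set $$\tilde L=\begin{pmatrix}L_1&0\\L_2C^T&L_2\end{pmatrix}\begin{pmatrix}I&0\\0&\tilde D_2\end{pmatrix},\qquad \tilde A=\tilde L\tilde L^T .$$ Then $\tilde A=A+E$, where $E$ is a positive semidefinite matrix and $$\frac{\|E\|_2}{\|A\|_2}\le\sigma_{r+1}^2\le\tau^2 .$$ In addition, $$\frac{\|\tilde L-L\|_2}{\|L\|_2}\le\frac{c\sqrt{1-\sigma_n^2}}{1-\sigma_1^2}\,\tau^2,$$ where $L$ is the lower triangular Cholesky factor of $A$, $c=1+2\lceil\log_2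 n\rceil$, and $\sigma_n$ is the $n$-th singular value of $C$ when $m\ge n$ and is $0$ otherwise. On the other hand, if $\tilde D_2$ in $\tilde L$ is replaced by the symmetric square root $(I-V_1\Sigma_1^2V_1^T)^{1/2}$, and $L$ is modified accordingly as $$L=\begin{pmatrix}L_1&0\\L_2C^T&L_2(I-V\Sigma^T\Sigma V^T)^{1/2}\end{pmatrix}$$ (so that $A=LL^T$ still holds), then $$\frac{\|\tilde L-L\|_2}{\|L\|_2}<\tau^2 .$$
   Context: All matrices are real. $\|\cdot\|_2$ is the spectral norm. Cholesky factors are lower triangular with positive diagonal entries. In the full SVD $C=U\Sigma V^T$, $U$ ($m\times m$) and $V$ ($n\times n$) are orthogonal and $\Sigma$ is an $m\times n$ rectangular diagonal matrix with the singular values on its diagonal in nonincreasing order. For a symmetric positive semidefinite matrix $M$, $M^{1/2}$ denotes its symmetric positive semidefinite square root. *)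

theory Defs
  imports Complex_Main "Jordan_Normal_Form.Gauss_Jordan_Elimination"
begin

definition vec_norm2 :: "real vec \<Rightarrow> real" where
  "vec_norm2 v = sqrt (v \<bullet> v)"

(* Operator norm induced by the Euclidean norms. The set is empty, and the supremum
   meaningless, for a matrix without columns. *)
definition spectral_norm :: "real mat \<Rightarrow> real" where
  "spectral_norm M =
     Sup {vec_norm2 (M *\<^sub>v x) | x. x \<in> carrier_vec (dim_col M) \<and> vec_norm2 x = 1}"

definition sym_pos_def :: "real mat \<Rightarrow> bool" where
  "sym_pos_def M \<longleftrightarrow> square_mat M \<and> transpose_mat M = M \<and>
     (\<forall>x \<in> carrier_vec (dim_row M). x \<noteq> 0\<^sub>v (dim_row M) \<longrightarrow> x \<bullet> (M *\<^sub>v x) > 0)"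

definition sym_pos_semidef :: "real mat \<Rightarrow> bool" where
  "sym_pos_semidef M \<longleftrightarrow> square_mat M \<and> transpose_mat M = M \<and>
     (\<forall>x \<in> carrier_vec (dim_row M). x \<bullet> (M *\<^sub>v x) \<ge> 0)"

definition psd_sqrt :: "real mat \<Rightarrow> real mat" where
  "psd_sqrt M = (THE S. sym_pos_semidef S \<and> S * S = M)"

definition cholesky_factor :: "real mat \<Rightarrow> real mat \<Rightarrow> bool" where
  "cholesky_factor M L \<longleftrightarrow>
     L \<in> carrier_mat (dim_row M) (dim_row M) \<and>
     (\<forall>i < dim_row L. \<forall>j < dim_col L. i < j \<longrightarrow> L $$ (i, j) = 0) \<and>
     (\<forall>i < dim_row L. L $$ (i, i) > 0) \<and>
     M = L * transpose_mat L"

(* The library's orthogonal_mat only asks for pairwise orthogonal nonzero columns. *)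
definition orthonormal_mat :: "real mat \<Rightarrow> bool" where
  "orthonormal_mat Q \<longleftrightarrow> square_mat Q \<and>
     transpose_mat Q * Q = 1\<^sub>m (dim_row Q) \<and> Q * transpose_mat Q = 1\<^sub>m (dim_row Q)"

(* The singular values of C are the diagonal entries of the factor Sg. *)
definition full_svd :: "real mat \<Rightarrow> real mat \<Rightarrow> real mat \<Rightarrow> real mat \<Rightarrow> bool" where
  "full_svd C U Sg V \<longleftrightarrow>
     U \<in> carrier_mat (dim_row C) (dim_row C) \<and> orthonormal_mat U \<and>
     V \<in> carrier_mat (dim_col C) (dim_col C) \<and> orthonormal_mat V \<and>
     Sg \<in> carrier_mat (dim_row C) (dim_col C) \<and> diagonal_mat Sg \<and>
     (\<forall>i < min (dim_row C) (dim_col C). Sg $$ (i, i) \<ge> 0) \<and>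
     (\<forall>i j. i \<le> j \<longrightarrow> j < min (dim_row C) (dim_col C) \<longrightarrow> Sg $$ (j, j) \<le> Sg $$ (i, i)) \<and>
     C = U * Sg * transpose_mat V"

(* Meaningful for invertible M only: mat_inverse returns None otherwise. *)
definition mat_inv :: "real mat \<Rightarrow> real mat" where
  "mat_inv M = the (mat_inverse M)"

end

theory Submission
  imports Defs "Jordan_Normal_Form.Determinant" "HOL-Analysis.L2_Norm"
begin

text \<open>
  Uniqueness of Cholesky factors forces \<open>L\<close> to have the blocks \<open>L\<^sub>1\<close>, \<open>L\<^sub>2 C\<^sup>T\<close>, \<open>L\<^sub>2 D\<close>, where
  \<open>D D\<^sup>T = I - C\<^sup>T C\<close>, so every difference in question is concentrated in the lower right block.
  There \<open>E\<close> equals \<open>L\<^sub>2 F L\<^sub>2\<^sup>T\<close>, where \<open>F\<close> is the discarded part of \<open>C\<^sup>T C\<close>, and \<open>\<parallel>L\<^sub>2\<parallel>\<^sup>2 \<le> \<parallel>A\<parallel>\<close>.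

  For the triangular factors \<open>D\<close> and \<open>D'\<close> (the paper's \<open>D\<^sub>2\<close> with tilde) write \<open>D' = D K\<close>,
  so that \<open>K K\<^sup>T = I + G\<close> with \<open>G = D\<^sup>-\<^sup>1 F D\<^sup>-\<^sup>T\<close> positive semidefinite.
  Then \<open>K - K\<^sup>-\<^sup>T = G K\<^sup>-\<^sup>T\<close>, where \<open>K\<close> is lower and \<open>K\<^sup>-\<^sup>T\<close> is upper triangular with
  \<open>\<parallel>K\<^sup>-\<^sup>T\<parallel> \<le> 1\<close>. Hence the strictly lower part of \<open>K\<close> is that of \<open>G K\<^sup>-\<^sup>T\<close>, and dyadic bisection bounds
  the norm of this truncation by \<open>\<lceil>log\<^sub>2 n\<rceil> \<parallel>G\<parallel>\<close>; on the diagonal \<open>0 \<le> K\<^sub>i\<^sub>i - 1 \<le> K\<^sub>i\<^sub>i - 1 / K\<^sub>i\<^sub>i \<le> \<parallel>G\<parallel>\<close>.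
  For the symmetric roots, the difference is diagonal in the basis \<open>V\<close>,
  with entries at most \<open>1 - sqrt (1 - \<sigma>\<^sub>r\<^sub>+\<^sub>1\<^sup>2)\<close>.
\<close>

section \<open>The Euclidean norm of vectors\<close>

lemma scalar_prod_self_nonneg: "(v :: real vec) \<bullet> v \<ge> 0"
  by (simp add: scalar_prod_def sum_nonneg)

lemma vec_norm2_nonneg [simp]: "vec_norm2 v \<ge> 0"
  by (simp add: vec_norm2_def scalar_prod_self_nonneg)

lemma vec_norm2_square: "(vec_norm2 v)\<^sup>2 = v \<bullet> v"
  by (simp add: vec_norm2_def scalar_prod_self_nonneg)

lemma vec_norm2_conv_sum: "vec_norm2 v = sqrt (\<Sum>i<dim_vec v. (v $ i)\<^sup>2)"
  by (simp add: vec_norm2_def scalar_prod_def power2_eq_square lessThan_atLeast0)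

lemma vec_norm2_zero [simp]: "vec_norm2 (0\<^sub>v n) = 0"
  by (simp add: vec_norm2_def)

lemma vec_norm2_eq_0_iff: "v \<in> carrier_vec n \<Longrightarrow> vec_norm2 v = 0 \<longleftrightarrow> v = 0\<^sub>v n"
  by (auto simp: vec_norm2_conv_sum sum_nonneg_eq_0_iff intro!: eq_vecI)

lemma vec_norm2_smult: "vec_norm2 (a \<cdot>\<^sub>v v) = \<bar>a\<bar> * vec_norm2 v"
  by (simp add: vec_norm2_conv_sum power_mult_distrib flip: sum_distrib_left)
     (simp add: real_sqrt_mult)

lemma vec_norm2_conv_L2_set: "v \<in> carrier_vec n \<Longrightarrow> vec_norm2 v = L2_set (($) v) {..<n}"
  by (auto simp: vec_norm2_conv_sum L2_set_def)

lemma scalar_prod_le_vec_norm2: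
  assumes "v \<in> carrier_vec n" "w \<in> carrier_vec n"
  shows "\<bar>v \<bullet> w\<bar> \<le> vec_norm2 v * vec_norm2 w"
proof -
  have "\<bar>v \<bullet> w\<bar> \<le> (\<Sum>i<n. \<bar>v $ i\<bar> * \<bar>w $ i\<bar>)"
    using assms by (auto simp: scalar_prod_def lessThan_atLeast0 simp flip: abs_mult)
  also have "\<dots> \<le> vec_norm2 v * vec_norm2 w"
    using assms by (simp add: vec_norm2_conv_L2_set L2_set_mult_ineq)
  finally show ?thesis .
qed

lemma vec_norm2_triangle:
  assumes "v \<in> carrier_vec n" "w \<in> carrier_vec n"
  shows "vec_norm2 (v + w) \<le> vec_norm2 v + vec_norm2 w"
proof -
  have "vec_norm2 (v + w) = L2_set (\<lambda>i. v $ i + w $ i) {..<n}"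
    using assms by (auto simp: vec_norm2_conv_L2_set[of _ n] L2_set_def)
  then show ?thesis
    using assms L2_set_triangle_ineq[of "($) v" "($) w" "{..<n}"]
    by (simp add: vec_norm2_conv_L2_set)
qed

lemma vec_norm2_append_square:
  assumes "v \<in> carrier_vec m" "w \<in> carrier_vec n"
  shows "(vec_norm2 (v @\<^sub>v w))\<^sup>2 = (vec_norm2 v)\<^sup>2 + (vec_norm2 w)\<^sup>2"
  unfolding vec_norm2_square using assms by (simp add: scalar_prod_append[of _ m _ n])

lemma vec_norm2_append_zero:
  assumes "w \<in> carrier_vec n"
  shows "vec_norm2 (0\<^sub>v m @\<^sub>v w) = vec_norm2 w"
  using vec_norm2_append_square[of "0\<^sub>v m" m w n] assms by simp

section \<open>Operator norm bounds\<close>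

text \<open>Working with upper bounds instead of the supremum postpones all questions of nonempty
  and bounded sets to the few passages to \<open>spectral_norm\<close>. The conjunct
  \<open>b \<ge> 0\<close> follows from the other one only if \<open>M\<close> has a column.\<close>

definition norm_bound :: "real mat \<Rightarrow> real \<Rightarrow> bool" where
  "norm_bound M b \<longleftrightarrow> b \<ge> 0 \<and>
     (\<forall>x \<in> carrier_vec (dim_col M). vec_norm2 (M *\<^sub>v x) \<le> b * vec_norm2 x)"

lemma norm_boundI:
  assumes "b \<ge> 0" "M \<in> carrier_mat nr nc"
    and "\<And>x. x \<in> carrier_vec nc \<Longrightarrow> vec_norm2 (M *\<^sub>v x) \<le> b * vec_norm2 x"
  shows "norm_bound M b"
  using assms by (auto simp: norm_bound_def)

lemma norm_boundD:
  "norm_bound M b \<Longrightarrow> M \<in> carrier_mat nr nc \<Longrightarrow> x \<in> carrier_vec nc \<Longrightarrow>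
     vec_norm2 (M *\<^sub>v x) \<le> b * vec_norm2 x"
  by (auto simp: norm_bound_def)

lemma norm_bound_nonneg: "norm_bound M b \<Longrightarrow> b \<ge> 0"
  by (simp add: norm_bound_def)

text \<open>The Frobenius norm is such a bound, by Cauchy-Schwarz on each row. This supplies the
  boundedness that the supremum in \<open>spectral_norm\<close> requires.\<close>

lemma norm_bound_exists: "\<exists>b. norm_bound M b"
proof -
  let ?b = "sqrt (\<Sum>i<dim_row M. (vec_norm2 (row M i))\<^sup>2)"
  have "vec_norm2 (M *\<^sub>v x) \<le> ?b * vec_norm2 x" if x: "x \<in> carrier_vec (dim_col M)" for x
  proof -
    have "(row M i \<bullet> x)\<^sup>2 \<le> (vec_norm2 (row M i))\<^sup>2 * (vec_norm2 x)\<^sup>2" for i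
    proof -
      have "\<bar>row M i \<bullet> x\<bar> \<le> vec_norm2 (row M i) * vec_norm2 x"
        by (rule scalar_prod_le_vec_norm2[OF _ x]) (rule row_carrier)
      then show ?thesis
        unfolding power_mult_distrib[symmetric] by (simp add: abs_le_square_iff[symmetric])
    qed
    then have "(\<Sum>i<dim_row M. (row M i \<bullet> x)\<^sup>2)
        \<le> (\<Sum>i<dim_row M. (vec_norm2 (row M i))\<^sup>2) * (vec_norm2 x)\<^sup>2"
      unfolding sum_distrib_right by (rule sum_mono)
    then have "sqrt (\<Sum>i<dim_row M. (row M i \<bullet> x)\<^sup>2)
        \<le> sqrt ((\<Sum>i<dim_row M. (vec_norm2 (row M i))\<^sup>2) * (vec_norm2 x)\<^sup>2)"
      by (rule real_sqrt_le_mono)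
    then show ?thesis
      by (simp add: vec_norm2_conv_sum[of "M *\<^sub>v x"] real_sqrt_mult)
  qed
  then show ?thesis
    by (intro exI[of _ ?b]) (simp add: norm_bound_def sum_nonneg)
qed

text \<open>A witness that the set under the supremum in \<open>spectral_norm\<close> is inhabited
  once there is a column.\<close>

lemma vec_norm2_unit_vec:
  assumes "0 < n"
  shows "unit_vec n 0 \<in> carrier_vec n \<and> vec_norm2 (unit_vec n 0) = 1"
  using assms by (simp add: vec_norm2_def)

lemma spectral_norm_le:
  assumes "norm_bound M b" "0 < dim_col M"
  shows "spectral_norm M \<le> b"
  unfolding spectral_norm_def
proof (rule cSup_least)
  show "{vec_norm2 (M *\<^sub>v x) |x. x \<in> carrier_vec (dim_col M) \<and> vec_norm2 x = 1} \<noteq> {}"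
    using vec_norm2_unit_vec[OF assms(2)] by blast
  show "y \<le> b" if "y \<in> {vec_norm2 (M *\<^sub>v x) |x. x \<in> carrier_vec (dim_col M) \<and> vec_norm2 x = 1}" for y
    using that assms(1) by (fastforce simp: norm_bound_def)
qed

lemma vec_norm2_mult_le_spectral_norm:
  assumes x: "x \<in> carrier_vec (dim_col M)" and "vec_norm2 x = 1"
  shows "vec_norm2 (M *\<^sub>v x) \<le> spectral_norm M"
  unfolding spectral_norm_def
proof (rule cSup_upper)
  obtain b where "norm_bound M b"
    using norm_bound_exists by blast
  then show "bdd_above {vec_norm2 (M *\<^sub>v x) |x. x \<in> carrier_vec (dim_col M) \<and> vec_norm2 x = 1}"
    by (intro bdd_aboveI[of _ b]) (fastforce simp: norm_bound_def)
qed (use assms in blast)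

lemma norm_bound_spectral_norm:
  assumes "0 < dim_col M"
  shows "norm_bound M (spectral_norm M)"
  unfolding norm_bound_def
proof (intro conjI ballI)
  show "0 \<le> spectral_norm M"
    using vec_norm2_unit_vec[OF assms]
    by (meson order_trans vec_norm2_mult_le_spectral_norm vec_norm2_nonneg)
next
  fix x :: "real vec" assume x: "x \<in> carrier_vec (dim_col M)"
  show "vec_norm2 (M *\<^sub>v x) \<le> spectral_norm M * vec_norm2 x"
  proof (cases "vec_norm2 x = 0")
    case True
    then have "x = 0\<^sub>v (dim_col M)"
      using vec_norm2_eq_0_iff[OF x] by blast
    moreover have "M *\<^sub>v 0\<^sub>v (dim_col M) = 0\<^sub>v (dim_row M)"
      by (intro eq_vecI) (auto intro!: scalar_prod_right_zero row_carrier)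
    ultimately show ?thesis by simp
  next
    case False
    then have pos: "vec_norm2 x > 0"
      using vec_norm2_nonneg[of x] by linarith
    \<comment> \<open>Homogeneity reduces the claim to a unit vector.\<close>
    let ?y = "(1 / vec_norm2 x) \<cdot>\<^sub>v x"
    have "vec_norm2 (M *\<^sub>v ?y) \<le> spectral_norm M"
      using x pos by (intro vec_norm2_mult_le_spectral_norm) (auto simp: vec_norm2_smult)
    moreover have "M *\<^sub>v ?y = (1 / vec_norm2 x) \<cdot>\<^sub>v (M *\<^sub>v x)"
      using x by (intro mult_mat_vec) auto
    ultimately show ?thesis
      using pos by (simp add: vec_norm2_smult divide_simps)
  qed
qed

lemma spectral_norm_nonneg: "0 < dim_col M \<Longrightarrow> 0 \<le> spectral_norm M"
  using norm_bound_spectral_norm norm_bound_nonneg by blast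

lemma norm_bound_mult:
  assumes M: "M \<in> carrier_mat p q" and N: "N \<in> carrier_mat q l"
    and a: "norm_bound M a" and b: "norm_bound N b"
  shows "norm_bound (M * N) (a * b)"
proof (rule norm_boundI)
  fix x :: "real vec" assume x: "x \<in> carrier_vec l"
  have "vec_norm2 (M *\<^sub>v (N *\<^sub>v x)) \<le> a * vec_norm2 (N *\<^sub>v x)"
    using norm_boundD[OF a M] N x by simp
  also have "\<dots> \<le> a * (b * vec_norm2 x)"
    using norm_boundD[OF b N x] norm_bound_nonneg[OF a] by (rule mult_left_mono)
  finally show "vec_norm2 (M * N *\<^sub>v x) \<le> a * b * vec_norm2 x"
    using M N x by simp
qed (use assms norm_bound_nonneg in auto)

lemma norm_bound_add:
  assumes M: "M \<in> carrier_mat p q" and N: "N \<in> carrier_mat p q"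
    and a: "norm_bound M a" and b: "norm_bound N b"
  shows "norm_bound (M + N) (a + b)"
proof (rule norm_boundI)
  fix x :: "real vec" assume x: "x \<in> carrier_vec q"
  have "vec_norm2 ((M + N) *\<^sub>v x) = vec_norm2 (M *\<^sub>v x + N *\<^sub>v x)"
    using M N x by (simp add: add_mult_distrib_mat_vec)
  also have "\<dots> \<le> vec_norm2 (M *\<^sub>v x) + vec_norm2 (N *\<^sub>v x)"
    using M N x by (intro vec_norm2_triangle[of _ p]) auto
  also have "\<dots> \<le> (a + b) * vec_norm2 x"
    using norm_boundD[OF a M x] norm_boundD[OF b N x] by (simp add: algebra_simps)
  finally show "vec_norm2 ((M + N) *\<^sub>v x) \<le> (a + b) * vec_norm2 x" .
qed (use assms norm_bound_nonneg in auto)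

text \<open>One factor moves across the scalar product. In this form every identity between Gram
  matrices \<open>M M^T\<close> becomes a comparison between the norms of their factors.\<close>

lemma vec_norm2_transpose_mult_square:
  assumes M: "M \<in> carrier_mat p q" and x: "x \<in> carrier_vec p"
  shows "(vec_norm2 (transpose_mat M *\<^sub>v x))\<^sup>2 = x \<bullet> (M * transpose_mat M *\<^sub>v x)"
  unfolding vec_norm2_square using M x
  by (subst transpose_vec_mult_scalar[OF M]) auto

text \<open>For \<open>y = M^T x\<close> the square of the norm of \<open>y\<close> is the scalar
  product of \<open>x\<close> and \<open>M y\<close>, which is at most \<open>b\<close> times the
  norms of \<open>x\<close> and \<open>y\<close>; one norm of \<open>y\<close> cancels.\<close>

lemma norm_bound_transpose:
  assumes M: "M \<in> carrier_mat p q" and b: "norm_bound M b"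
  shows "norm_bound (transpose_mat M) b"
proof (rule norm_boundI[of _ _ q p])
  fix x :: "real vec" assume x: "x \<in> carrier_vec p"
  let ?y = "transpose_mat M *\<^sub>v x"
  have y: "?y \<in> carrier_vec q" using M x by simp
  have "vec_norm2 ?y * vec_norm2 ?y = x \<bullet> (M *\<^sub>v ?y)"
    using transpose_vec_mult_scalar[OF M y x] by (simp add: vec_norm2_square[symmetric] power2_eq_square)
  also have "\<dots> \<le> vec_norm2 x * vec_norm2 (M *\<^sub>v ?y)"
    using scalar_prod_le_vec_norm2[of x p "M *\<^sub>v ?y"] M x by auto
  also have "\<dots> \<le> vec_norm2 x * (b * vec_norm2 ?y)"
    using norm_boundD[OF b M y] by (intro mult_left_mono) auto
  finally have "vec_norm2 ?y * vec_norm2 ?y \<le> (b * vec_norm2 x) * vec_norm2 ?y"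
    by (simp add: mult_ac)
  then show "vec_norm2 ?y \<le> b * vec_norm2 x"
    using norm_bound_nonneg[OF b] vec_norm2_nonneg[of ?y] vec_norm2_nonneg[of x]
    by (cases "vec_norm2 ?y = 0") (auto simp: mult_le_cancel_right)
qed (use assms norm_bound_nonneg in auto)

text \<open>The matrix acts on the last \<open>n\<close> coordinates only, and dropping the first
  \<open>m\<close> coordinates does not increase the norm.\<close>

lemma norm_bound_four_block_corner:
  assumes X: "X \<in> carrier_mat n n" and b: "norm_bound X b"
  shows "norm_bound (four_block_mat (0\<^sub>m m m) (0\<^sub>m m n) (0\<^sub>m n m) X) b"
proof (rule norm_boundI[of _ _ "m + n" "m + n"])
  fix x :: "real vec" assume x: "x \<in> carrier_vec (m + n)"
  define x1 where "x1 = vec_first x m"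
  define x2 where "x2 = vec_last x n"
  have xs: "x1 \<in> carrier_vec m" "x2 \<in> carrier_vec n" and xeq: "x = x1 @\<^sub>v x2"
    using x by (simp_all add: x1_def x2_def)
  have "four_block_mat (0\<^sub>m m m) (0\<^sub>m m n) (0\<^sub>m n m) X *\<^sub>v x = 0\<^sub>v m @\<^sub>v (X *\<^sub>v x2)"
    unfolding xeq using X xs by (subst mult_mat_vec_split[of _ m _ n]) auto
  then have "vec_norm2 (four_block_mat (0\<^sub>m m m) (0\<^sub>m m n) (0\<^sub>m n m) X *\<^sub>v x) = vec_norm2 (X *\<^sub>v x2)"
    using X xs by (simp add: vec_norm2_append_zero[of _ n])
  also have "\<dots> \<le> b * vec_norm2 x2"
    using norm_boundD[OF b X] xs by simp
  also have "\<dots> \<le> b * vec_norm2 x"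
  proof (rule mult_left_mono[OF _ norm_bound_nonneg[OF b]])
    have "(vec_norm2 x2)\<^sup>2 \<le> (vec_norm2 x)\<^sup>2"
      unfolding xeq vec_norm2_append_square[OF xs] by simp
    then show "vec_norm2 x2 \<le> vec_norm2 x" by (rule power2_le_imp_le) simp
  qed
  finally show "vec_norm2 (four_block_mat (0\<^sub>m m m) (0\<^sub>m m n) (0\<^sub>m n m) X *\<^sub>v x) \<le> b * vec_norm2 x" .
qed (use assms norm_bound_nonneg in auto)

section \<open>Triangular factors and triangular truncation\<close>

text \<open>The triangular half of \<open>cholesky_factor\<close>, detached from the factorized
  matrix so that it also applies to quotients and inverses of factors.\<close>

definition lower_pos :: "nat \<Rightarrow> real mat \<Rightarrow> bool" where
  "lower_pos n L \<longleftrightarrow> L \<in> carrier_mat n n \<and>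
     (\<forall>i<n. \<forall>j<n. i < j \<longrightarrow> L $$ (i, j) = 0) \<and> (\<forall>i<n. L $$ (i, i) > 0)"

lemma cholesky_factor_iff:
  "cholesky_factor M L \<longleftrightarrow> lower_pos (dim_row M) L \<and> M = L * transpose_mat L"
proof (cases "L \<in> carrier_mat (dim_row M) (dim_row M)")
  case True
  then have "dim_row L = dim_row M" "dim_col L = dim_row M" by auto
  then show ?thesis
    unfolding cholesky_factor_def lower_pos_def by simp
qed (simp add: cholesky_factor_def lower_pos_def)

lemma lower_pos_carrier: "lower_pos n L \<Longrightarrow> L \<in> carrier_mat n n"
  by (simp add: lower_pos_def)

lemma lower_pos_one: "lower_pos n (1\<^sub>m n)"
  by (simp add: lower_pos_def)

text \<open>The determinant is the product of the positive diagonal entries, so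
  \<open>mat_inverse\<close> does not return \<open>None\<close> and \<open>mat_inv\<close> is a
  genuine inverse.\<close>

lemma lower_pos_mat_inv:
  assumes L: "lower_pos n L"
  shows "mat_inv L \<in> carrier_mat n n" "L * mat_inv L = 1\<^sub>m n" "mat_inv L * L = 1\<^sub>m n"
proof -
  note Lc = lower_pos_carrier[OF L]
  have "det L = prod_list (diag_mat L)"
    using L by (intro det_lower_triangular[OF _ Lc]) (auto simp: lower_pos_def)
  moreover have "0 \<notin> set (diag_mat L)"
    using L Lc by (auto simp: diag_mat_def lower_pos_def)
  ultimately have "det L \<noteq> 0"
    by (simp add: prod_list_zero_iff)
  then obtain J where "mat_inverse L = Some J"
    using mat_inverse(1)[OF Lc, of "()"] det_non_zero_imp_unit[OF Lc, of "()"] by blast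
  then show "mat_inv L \<in> carrier_mat n n" "L * mat_inv L = 1\<^sub>m n" "mat_inv L * L = 1\<^sub>m n"
    using mat_inverse(2)[OF Lc] by (auto simp: mat_inv_def)
qed

lemma index_mult_mat_sum:
  assumes "M \<in> carrier_mat p q" "N \<in> carrier_mat q l" "i < p" "j < l"
  shows "(M * N) $$ (i, j) = (\<Sum>k<q. M $$ (i, k) * N $$ (k, j))"
  using assms by (simp add: scalar_prod_def lessThan_atLeast0)

text \<open>Forward substitution, by induction on the row. With \<open>D K = I\<close> it gives the
  triangularity of inverses, and with two Cholesky factors \<open>D\<close> and \<open>D K\<close>
  that of their quotient.\<close>

lemma lower_pos_left_quotient:
  assumes D: "lower_pos n D" and K: "K \<in> carrier_mat n n" and DK: "lower_pos n (D * K)"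
  shows "lower_pos n K" and "i < n \<Longrightarrow> (D * K) $$ (i, i) = D $$ (i, i) * K $$ (i, i)"
proof -
  note Dc = lower_pos_carrier[OF D]
  have upper: "K $$ (i, j) = 0" if "i < j" "j < n" for i j
    using that
  proof (induction i rule: less_induct)
    case (less i)
    have "0 = (\<Sum>k<n. D $$ (i, k) * K $$ (k, j))"
      using less.prems DK index_mult_mat_sum[OF Dc K, of i j] by (auto simp: lower_pos_def)
    \<comment> \<open>Terms with \<open>k < i\<close> vanish by the induction hypothesis, those with
      \<open>k > i\<close> because \<open>D\<close> is lower triangular.\<close>
    also have "\<dots> = (\<Sum>k<n. if k = i then D $$ (i, i) * K $$ (i, j) else 0)"
    proof (rule sum.cong)
      fix k assume k: "k \<in> {..<n}"
      show "D $$ (i, k) * K $$ (k, j) = (if k = i then D $$ (i, i) * K $$ (i, j) else 0)"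
      proof (cases k i rule: linorder_cases)
        case less
        then show ?thesis using less.IH less.prems by simp
      next
        case greater
        then show ?thesis using D k less.prems by (simp add: lower_pos_def)
      qed simp
    qed simp
    also have "\<dots> = D $$ (i, i) * K $$ (i, j)"
      using less.prems by simp
    finally have "D $$ (i, i) * K $$ (i, j) = 0" by simp
    moreover have "D $$ (i, i) > 0"
      using D less.prems by (simp add: lower_pos_def)
    ultimately show ?case by simp
  qed
  have diag: "(D * K) $$ (i, i) = D $$ (i, i) * K $$ (i, i)" if i: "i < n" for i
  proof -
    have "(D * K) $$ (i, i) = (\<Sum>k<n. D $$ (i, k) * K $$ (k, i))"
      using i by (intro index_mult_mat_sum[OF Dc K])
    also have "\<dots> = (\<Sum>k<n. if k = i then D $$ (i, i) * K $$ (i, i) else 0)"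
    proof (rule sum.cong)
      fix k assume k: "k \<in> {..<n}"
      show "D $$ (i, k) * K $$ (k, i) = (if k = i then D $$ (i, i) * K $$ (i, i) else 0)"
      proof (cases k i rule: linorder_cases)
        case less
        then show ?thesis using upper i by simp
      next
        case greater
        then show ?thesis using D k i by (simp add: lower_pos_def)
      qed simp
    qed simp
    also have "\<dots> = D $$ (i, i) * K $$ (i, i)"
      using i by simp
    finally show ?thesis .
  qed
  show "i < n \<Longrightarrow> (D * K) $$ (i, i) = D $$ (i, i) * K $$ (i, i)"
    by (rule diag)
  have "K $$ (i, i) > 0" if "i < n" for i
  proof -
    have "0 < (D * K) $$ (i, i)" and D_pos: "0 < D $$ (i, i)"
      using that D DK unfolding lower_pos_def by blast+
    then have "0 < D $$ (i, i) * K $$ (i, i)"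
      unfolding diag[OF that] by simp
    then show ?thesis
      using D_pos by (rule zero_less_mult_pos)
  qed
  then show "lower_pos n K"
    using K upper by (simp add: lower_pos_def)
qed

lemma lower_pos_mat_inv_triangular:
  assumes L: "lower_pos n L"
  shows "lower_pos n (mat_inv L)" and "i < n \<Longrightarrow> L $$ (i, i) * mat_inv L $$ (i, i) = 1"
  using lower_pos_left_quotient[OF L lower_pos_mat_inv(1)[OF L]] lower_pos_one[of n]
  by (auto simp: lower_pos_mat_inv[OF L])

lemma transpose_mat_inv_cancel:
  assumes L: "lower_pos n L"
  shows "transpose_mat L * transpose_mat (mat_inv L) = 1\<^sub>m n"
    and "transpose_mat (mat_inv L) * transpose_mat L = 1\<^sub>m n"
  using lower_pos_mat_inv[OF L] lower_pos_carrier[OF L]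
  by (simp_all flip: transpose_mult[of _ n n _ n])

text \<open>The quotient \<open>K = L^-1 M\<close> is lower triangular with
  \<open>K K^T = I\<close>. The quotient lemma, applied to this product, makes \<open>K^T\<close>
  lower triangular as well; so \<open>K\<close> is diagonal, and its positive entries have square
  1.\<close>

lemma lower_pos_gram_unique:
  assumes L: "lower_pos n L" and M: "lower_pos n M"
    and eq: "L * transpose_mat L = M * transpose_mat M"
  shows "L = M"
proof -
  note c = lower_pos_carrier[OF L] lower_pos_carrier[OF M] lower_pos_mat_inv(1)[OF L]
  define K where "K = mat_inv L * M"
  have K: "K \<in> carrier_mat n n" using c by (simp add: K_def)
  have LK: "L * K = M"
    using c by (simp add: K_def lower_pos_mat_inv[OF L] flip: assoc_mult_mat[of _ n n _ n _ n])
  then have Kl: "lower_pos n K"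
    using lower_pos_left_quotient[OF L K] M by simp
  have "K * transpose_mat K = mat_inv L * (M * transpose_mat M) * transpose_mat (mat_inv L)"
    using c by (simp add: K_def transpose_mult[of _ n n _ n] assoc_mult_mat[of _ n n _ n _ n])
  also have "\<dots> = (mat_inv L * L) * (transpose_mat L * transpose_mat (mat_inv L))"
    using c by (simp add: eq[symmetric] assoc_mult_mat[of _ n n _ n _ n])
  finally have KK: "K * transpose_mat K = 1\<^sub>m n"
    by (simp add: lower_pos_mat_inv[OF L] transpose_mat_inv_cancel[OF L])
  have Kt: "transpose_mat K \<in> carrier_mat n n" using K by simp
  have lKK: "lower_pos n (K * transpose_mat K)"
    using KK lower_pos_one by simp
  have Ktl: "lower_pos n (transpose_mat K)"
    by (rule lower_pos_left_quotient(1)[OF Kl Kt lKK])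
  have "K $$ (i, i) = 1" if i: "i < n" for i
  proof -
    have "K $$ (i, i) * K $$ (i, i) = 1" "K $$ (i, i) > 0"
      using lower_pos_left_quotient(2)[OF Kl Kt lKK i] KK i K Kl by (auto simp: lower_pos_def)
    then show ?thesis by (simp add: square_eq_1_iff)
  qed
  moreover have "K $$ (i, j) = 0" if "i < n" "j < n" "i \<noteq> j" for i j
    using that Kl Ktl K by (cases "i < j") (auto simp: lower_pos_def)
  ultimately have "K = 1\<^sub>m n"
    using K by (intro eq_matI) auto
  then show ?thesis using LK c by simp
qed

section \<open>Bilinear forms and triangular truncation by bisection\<close>

lemma norm_bound_bilinear:
  assumes M: "M \<in> carrier_mat n n" and b: "norm_bound M b" and "S \<subseteq> {..<n}" "T \<subseteq> {..<n}"
  shows "\<bar>\<Sum>i\<in>S. \<Sum>j\<in>T. x i * M $$ (i, j) * y j\<bar> \<le> b * L2_set x S * L2_set y T"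
proof -
  \<comment> \<open>Zero padding outside \<open>S\<close> and \<open>T\<close>: a submatrix inherits
    every norm bound of \<open>M\<close>.\<close>
  define v where "v = vec n (\<lambda>i. if i \<in> S then x i else 0)"
  define w where "w = vec n (\<lambda>i. if i \<in> T then y i else 0)"
  have vw: "v \<in> carrier_vec n" "w \<in> carrier_vec n" by (auto simp: v_def w_def)
  have restrict: "(\<Sum>i<n. if i \<in> R then f i else 0) = sum f R" if "R \<subseteq> {..<n}" for R and f :: "nat \<Rightarrow> real"
    using that by (simp add: sum.If_cases Int_absorb1)
  have "v \<bullet> (M *\<^sub>v w) = (\<Sum>i<n. if i \<in> S then x i * (\<Sum>j<n. M $$ (i, j) * w $ j) else 0)"
    using M vw by (auto simp: scalar_prod_def lessThan_atLeast0 v_def intro!: sum.cong)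
  also have "\<dots> = (\<Sum>i\<in>S. x i * (\<Sum>j<n. M $$ (i, j) * w $ j))"
    using assms(3) by (rule restrict)
  also have "\<dots> = (\<Sum>i\<in>S. x i * (\<Sum>j<n. if j \<in> T then M $$ (i, j) * y j else 0))"
    by (intro sum.cong refl arg_cong2[where f = "(*)"]) (auto simp: w_def)
  also have "\<dots> = (\<Sum>i\<in>S. \<Sum>j\<in>T. x i * M $$ (i, j) * y j)"
    by (simp add: restrict[OF assms(4)] sum_distrib_left mult.assoc)
  finally have "\<bar>\<Sum>i\<in>S. \<Sum>j\<in>T. x i * M $$ (i, j) * y j\<bar> = \<bar>v \<bullet> (M *\<^sub>v w)\<bar>" by simp
  also have "\<dots> \<le> vec_norm2 v * vec_norm2 (M *\<^sub>v w)"
    using M vw by (intro scalar_prod_le_vec_norm2[of _ n]) auto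
  also have "\<dots> \<le> vec_norm2 v * (b * vec_norm2 w)"
    using norm_boundD[OF b M vw(2)] by (intro mult_left_mono) auto
  also have "vec_norm2 v = L2_set x S"
    unfolding vec_norm2_conv_L2_set[OF vw(1)] L2_set_def restrict[OF assms(3), symmetric]
    by (intro arg_cong[where f = sqrt] sum.cong) (auto simp: v_def)
  also have "vec_norm2 w = L2_set y T"
    unfolding vec_norm2_conv_L2_set[OF vw(2)] L2_set_def restrict[OF assms(4), symmetric]
    by (intro arg_cong[where f = sqrt] sum.cong) (auto simp: w_def)
  finally show ?thesis by (simp add: mult_ac)
qed

lemma norm_bound_index:
  assumes "M \<in> carrier_mat n n" "norm_bound M b" "i < n" "j < n"
  shows "\<bar>M $$ (i, j)\<bar> \<le> b"
  using norm_bound_bilinear[OF assms(1,2), of "{i}" "{j}" "\<lambda>_. 1" "\<lambda>_. 1"] assms(3,4)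
  by simp

text \<open>The form is tested with the vector \<open>M x\<close> itself, and one factor
  \<open>vec_norm2 (M x)\<close> cancels.\<close>

lemma norm_boundI_bilinear:
  assumes M: "M \<in> carrier_mat n n" and "b \<ge> 0"
    and le: "\<And>x y. x \<in> carrier_vec n \<Longrightarrow> y \<in> carrier_vec n \<Longrightarrow>
      x \<bullet> (M *\<^sub>v y) \<le> b * vec_norm2 x * vec_norm2 y"
  shows "norm_bound M b"
proof (rule norm_boundI[OF \<open>b \<ge> 0\<close> M])
  fix x :: "real vec" assume x: "x \<in> carrier_vec n"
  have "vec_norm2 (M *\<^sub>v x) * vec_norm2 (M *\<^sub>v x) \<le> vec_norm2 (M *\<^sub>v x) * (b * vec_norm2 x)"
    using le[of "M *\<^sub>v x" x] M x
    by (simp add: mult_ac power2_eq_square flip: vec_norm2_square)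
  then show "vec_norm2 (M *\<^sub>v x) \<le> b * vec_norm2 x"
    using \<open>b \<ge> 0\<close> vec_norm2_nonneg[of "M *\<^sub>v x"] vec_norm2_nonneg[of x]
    by (cases "vec_norm2 (M *\<^sub>v x) = 0") (auto simp: mult_le_cancel_left)
qed

lemma mult_add_mult_le_sqrt:
  fixes p q r s :: real
  shows "p * q + r * s \<le> sqrt (p\<^sup>2 + r\<^sup>2) * sqrt (q\<^sup>2 + s\<^sup>2)"
proof -
  have "(p * q + r * s)\<^sup>2 \<le> (p\<^sup>2 + r\<^sup>2) * (q\<^sup>2 + s\<^sup>2)"
    using zero_le_power2[of "p * s - r * q"] by (simp add: power2_eq_square algebra_simps)
  then show ?thesis
    unfolding real_sqrt_mult[symmetric] by (rule real_le_rsqrt)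
qed

text \<open>An index interval cut at \<open>c\<close> splits the strict lower triangle into two
  triangles of half the size and a full rectangle with rows from \<open>c\<close> on and columns
  before \<open>c\<close>. The two triangles use disjoint rows and disjoint columns, so by
  Cauchy-Schwarz their bounds combine without doubling; the rectangle is a submatrix and costs one
  further \<open>\<eta>\<close> per level.\<close>

lemma triangular_truncation_bilinear:
  assumes M: "M \<in> carrier_mat n n" and eta: "norm_bound M \<eta>"
  shows "b \<le> n \<Longrightarrow> b - a \<le> 2 ^ k \<Longrightarrow>
    \<bar>\<Sum>i\<in>{a..<b}. \<Sum>j\<in>{a..<i}. x i * M $$ (i, j) * y j\<bar>
      \<le> real k * \<eta> * L2_set x {a..<b} * L2_set y {a..<b}"
proof (induction k arbitrary: a b)
  case 0
  have "(\<Sum>i\<in>{a..<b}. \<Sum>j\<in>{a..<i}. x i * M $$ (i, j) * y j) = 0"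
    using 0 by (intro sum.neutral ballI) auto
  then show ?case by simp
next
  case (Suc k)
  let ?f = "\<lambda>i j. x i * M $$ (i, j) * y j"
  have eta0: "\<eta> \<ge> 0" using norm_bound_nonneg[OF eta] .
  show ?case
  proof (cases "b - a \<le> 2 ^ k")
    case True
    have "real k * \<eta> * L2_set x {a..<b} * L2_set y {a..<b}
        \<le> real (Suc k) * \<eta> * L2_set x {a..<b} * L2_set y {a..<b}"
      using eta0 by (intro mult_right_mono) auto
    then show ?thesis using Suc.IH[OF Suc.prems(1) True] by linarith
  next
    case False
    \<comment> \<open>The left part has exactly \<open>2 ^ k\<close> indices, which leaves at most
      \<open>2 ^ k\<close> for the right part.\<close>
    define c where "c = a + 2 ^ k"
    have c: "a \<le> c" "c \<le> b" "c \<le> n" "c - a \<le> 2 ^ k" "b - c \<le> 2 ^ k"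
      using False Suc.prems by (auto simp: c_def)
    have split: "sum g {a..<b} = sum g {a..<c} + sum g {c..<b}" for g :: "nat \<Rightarrow> real"
      using c by (simp add: sum.atLeastLessThan_concat)
    define p r q s where "p = L2_set x {a..<c}" and "r = L2_set x {c..<b}"
      and "q = L2_set y {a..<c}" and "s = L2_set y {c..<b}"
    note defs = p_def r_def q_def s_def
    have xnorm: "L2_set x {a..<b} = sqrt (p\<^sup>2 + r\<^sup>2)" and ynorm: "L2_set y {a..<b} = sqrt (q\<^sup>2 + s\<^sup>2)"
      by (simp_all add: L2_set_def split defs sum_nonneg)
    have "(\<Sum>i\<in>{c..<b}. \<Sum>j\<in>{a..<i}. ?f i j)
        = (\<Sum>i\<in>{c..<b}. (\<Sum>j\<in>{a..<c}. ?f i j) + (\<Sum>j\<in>{c..<i}. ?f i j))"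
      using c by (intro sum.cong refl) (simp add: sum.atLeastLessThan_concat)
    then have "(\<Sum>i\<in>{a..<b}. \<Sum>j\<in>{a..<i}. ?f i j)
      = (\<Sum>i\<in>{a..<c}. \<Sum>j\<in>{a..<i}. ?f i j) + (\<Sum>i\<in>{c..<b}. \<Sum>j\<in>{c..<i}. ?f i j)
        + (\<Sum>i\<in>{c..<b}. \<Sum>j\<in>{a..<c}. ?f i j)"
      by (simp add: split sum.distrib)
    moreover have "\<bar>\<Sum>i\<in>{a..<c}. \<Sum>j\<in>{a..<i}. ?f i j\<bar> \<le> real k * \<eta> * p * q"
      using Suc.IH[OF c(3,4)] by (simp add: defs)
    moreover have "\<bar>\<Sum>i\<in>{c..<b}. \<Sum>j\<in>{c..<i}. ?f i j\<bar> \<le> real k * \<eta> * r * s"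
      using Suc.IH[OF Suc.prems(1) c(5)] by (simp add: defs)
    moreover have "\<bar>\<Sum>i\<in>{c..<b}. \<Sum>j\<in>{a..<c}. ?f i j\<bar> \<le> \<eta> * r * q"
      unfolding defs using c Suc.prems by (intro norm_bound_bilinear[OF M eta]) auto
    moreover have "real k * \<eta> * p * q + real k * \<eta> * r * s
        \<le> real k * \<eta> * (sqrt (p\<^sup>2 + r\<^sup>2) * sqrt (q\<^sup>2 + s\<^sup>2))"
      using mult_left_mono[OF mult_add_mult_le_sqrt[of p q r s], of "real k * \<eta>"] eta0
      by (simp add: algebra_simps)
    moreover have "\<eta> * r * q \<le> \<eta> * (sqrt (p\<^sup>2 + r\<^sup>2) * sqrt (q\<^sup>2 + s\<^sup>2))"
      using eta0
        mult_mono[of "sqrt (r\<^sup>2)" "sqrt (p\<^sup>2 + r\<^sup>2)" "sqrt (q\<^sup>2)" "sqrt (q\<^sup>2 + s\<^sup>2)"]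
      unfolding mult.assoc by (intro mult_left_mono) (auto simp: defs)
    ultimately show ?thesis
      unfolding xnorm ynorm by (simp add: algebra_simps)
  qed
qed

text \<open>The diagonal is cut off too: intervals with one index then contribute nothing to the
  bisection, and the diagonal of a Cholesky factor gets a sharper estimate of its own.\<close>

definition strict_lower :: "real mat \<Rightarrow> real mat" where
  "strict_lower M = mat (dim_row M) (dim_col M) (\<lambda>(i, j). if j < i then M $$ (i, j) else 0)"

lemma norm_bound_strict_lower:
  assumes M: "M \<in> carrier_mat n n" and eta: "norm_bound M \<eta>" and k: "n \<le> 2 ^ k"
  shows "norm_bound (strict_lower M) (real k * \<eta>)"
proof (rule norm_boundI_bilinear[of _ n])
  show N: "strict_lower M \<in> carrier_mat n n"
    using M by (simp add: strict_lower_def)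
  show "0 \<le> real k * \<eta>"
    using norm_bound_nonneg[OF eta] by simp
  fix x y :: "real vec" assume xy: "x \<in> carrier_vec n" "y \<in> carrier_vec n"
  have "x \<bullet> (strict_lower M *\<^sub>v y)
      = (\<Sum>i<n. \<Sum>j<n. x $ i * (strict_lower M $$ (i, j) * y $ j))"
    using N xy by (simp add: scalar_prod_def lessThan_atLeast0 sum_distrib_left)
  also have "\<dots> = (\<Sum>i\<in>{0..<n}. \<Sum>j\<in>{0..<i}. x $ i * M $$ (i, j) * y $ j)"
    unfolding lessThan_atLeast0
  proof (rule sum.cong[OF refl])
    fix i assume i: "i \<in> {0..<n}"
    show "(\<Sum>j\<in>{0..<n}. x $ i * (strict_lower M $$ (i, j) * y $ j))
        = (\<Sum>j\<in>{0..<i}. x $ i * M $$ (i, j) * y $ j)"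
      using i M by (intro sum.mono_neutral_cong_right) (auto simp: strict_lower_def)
  qed
  also have "\<dots> \<le> real k * \<eta> * vec_norm2 x * vec_norm2 y"
    using triangular_truncation_bilinear[OF M eta, of n 0 k "($) x" "($) y"] k
    by (simp add: vec_norm2_conv_L2_set[OF xy(1)] vec_norm2_conv_L2_set[OF xy(2)] lessThan_atLeast0)
  finally show "x \<bullet> (strict_lower M *\<^sub>v y) \<le> real k * \<eta> * vec_norm2 x * vec_norm2 y" .
qed

lemma mat_diag_mult_vec:
  assumes "x \<in> carrier_vec n"
  shows "mat_diag n d *\<^sub>v x = vec n (\<lambda>i. d i * x $ i)"
  using assms
  by (intro eq_vecI)
    (auto simp: mat_diag_def scalar_prod_def if_distrib[where f = "\<lambda>a. a * _"] cong: if_cong)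

lemma norm_bound_mat_diag:
  assumes b: "b \<ge> 0" and "\<And>i. i < n \<Longrightarrow> \<bar>d i\<bar> \<le> b"
  shows "norm_bound (mat_diag n d) b"
proof (rule norm_boundI[OF b mat_diag_dim])
  fix x :: "real vec" assume x: "x \<in> carrier_vec n"
  have "(d i * x $ i)\<^sup>2 \<le> (b * x $ i)\<^sup>2" if "i < n" for i
    using assms(2)[OF that] b by (auto simp: abs_mult intro!: mult_right_mono simp flip: abs_le_square_iff)
  then have "(\<Sum>i<n. (d i * x $ i)\<^sup>2) \<le> (\<Sum>i<n. (b * x $ i)\<^sup>2)"
    by (intro sum_mono) auto
  then have "sqrt (\<Sum>i<n. (d i * x $ i)\<^sup>2) \<le> sqrt (\<Sum>i<n. (b * x $ i)\<^sup>2)"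
    by (rule real_sqrt_le_mono)
  then have "vec_norm2 (mat_diag n d *\<^sub>v x) \<le> vec_norm2 (b \<cdot>\<^sub>v x)"
    using x by (simp add: mat_diag_mult_vec vec_norm2_conv_sum)
  then show "vec_norm2 (mat_diag n d *\<^sub>v x) \<le> b * vec_norm2 x"
    using b by (simp add: vec_norm2_smult)
qed

text \<open>With \<open>J = K^-1\<close>, the hypothesis turns into \<open>K = J^T + M\<close> for
  \<open>M = G J^T\<close>. As \<open>J^T\<close> is upper triangular, \<open>K\<close> and
  \<open>M\<close> agree below the diagonal, where truncation costs \<open>k\<close> times
  \<open>\<eta>\<close>; the diagonal adds one more \<open>\<eta>\<close>.\<close>

lemma norm_bound_cholesky_minus_one:
  assumes K: "lower_pos n K" and G: "G \<in> carrier_mat n n"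
    and KK: "K * transpose_mat K = 1\<^sub>m n + G"
    and psd: "\<And>x. x \<in> carrier_vec n \<Longrightarrow> 0 \<le> x \<bullet> (G *\<^sub>v x)"
    and eta: "norm_bound G \<eta>" and k: "n \<le> 2 ^ k"
  shows "norm_bound (K - 1\<^sub>m n) ((1 + real k) * \<eta>)"
proof -
  define J where "J = mat_inv K"
  have Kc: "K \<in> carrier_mat n n" using lower_pos_carrier[OF K] .
  have J: "lower_pos n J" unfolding J_def by (rule lower_pos_mat_inv_triangular[OF K])
  have Jc: "J \<in> carrier_mat n n" using lower_pos_carrier[OF J] .
  have Jt: "transpose_mat J \<in> carrier_mat n n" using Jc by simp
  have KJ: "transpose_mat K * transpose_mat J = 1\<^sub>m n"
    unfolding J_def by (rule transpose_mat_inv_cancel[OF K])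
  define M where "M = G * transpose_mat J"
  have Mc: "M \<in> carrier_mat n n" using G Jc by (simp add: M_def)
  have "K = K * transpose_mat K * transpose_mat J"
    using Kc Jc KJ by (simp add: assoc_mult_mat[of _ n n _ n _ n])
  also have "\<dots> = transpose_mat J + M"
    using G Jc by (simp add: KK M_def add_mult_distrib_mat[of _ n n _ _ n])
  finally have KM: "K = transpose_mat J + M" .
  \<comment> \<open>Semidefiniteness of \<open>G\<close> means that \<open>K^T\<close> does not
    shrink any vector \<open>w\<close>; the choice \<open>w = J^T x\<close> gives the bound for its
    inverse.\<close>
  have J1: "norm_bound (transpose_mat J) 1"
  proof (rule norm_boundI[OF _ Jt])
    fix x :: "real vec" assume x: "x \<in> carrier_vec n"
    let ?w = "transpose_mat J *\<^sub>v x"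
    have w: "?w \<in> carrier_vec n" using Jc x by simp
    have "transpose_mat K *\<^sub>v ?w = x"
      using KJ Kc Jt x by (simp flip: assoc_mult_mat_vec[of _ n n _ n])
    then have "(vec_norm2 x)\<^sup>2 = ?w \<bullet> ((1\<^sub>m n + G) *\<^sub>v ?w)"
      using vec_norm2_transpose_mult_square[OF Kc w] KK by simp
    also have "\<dots> = (vec_norm2 ?w)\<^sup>2 + ?w \<bullet> (G *\<^sub>v ?w)"
      unfolding vec_norm2_square using G w
      by (simp add: add_mult_distrib_mat_vec[of _ n n] scalar_prod_add_distrib[of _ n])
    finally have "(vec_norm2 ?w)\<^sup>2 \<le> (vec_norm2 x)\<^sup>2"
      using psd[OF w] by simp
    then show "vec_norm2 ?w \<le> 1 * vec_norm2 x"
      using power2_le_imp_le[OF _ vec_norm2_nonneg] by simp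
  qed simp
  have Meta: "norm_bound M \<eta>"
    using norm_bound_mult[OF G Jt eta J1] by (simp add: M_def)
  \<comment> \<open>From \<open>K_ii J_ii = 1\<close> and \<open>J_ii \<le> 1\<close> follows
    \<open>K_ii \<ge> 1\<close>, while \<open>K_ii = J_ii + M_ii\<close> is at most
    \<open>1 + \<eta>\<close>.\<close>
  have diag: "\<bar>K $$ (i, i) - 1\<bar> \<le> \<eta>" if i: "i < n" for i
  proof -
    have "K $$ (i, i) * J $$ (i, i) = 1" "K $$ (i, i) > 0"
      using lower_pos_mat_inv_triangular(2)[OF K i] K i by (auto simp: J_def lower_pos_def)
    moreover have "J $$ (i, i) \<le> 1"
      using norm_bound_index[OF Jt J1 i i] i Jc by simp
    ultimately have "1 \<le> K $$ (i, i)"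
      using mult_left_mono[of "J $$ (i, i)" 1 "K $$ (i, i)"] by linarith
    moreover have "K $$ (i, i) = J $$ (i, i) + M $$ (i, i)"
      using arg_cong[OF KM, of "\<lambda>X. X $$ (i, i)"] i Jc Mc by simp
    moreover have "M $$ (i, i) \<le> \<eta>"
      using norm_bound_index[OF Mc Meta i i] by linarith
    ultimately show ?thesis
      using \<open>J $$ (i, i) \<le> 1\<close> by linarith
  qed
  have "K - 1\<^sub>m n = mat_diag n (\<lambda>i. K $$ (i, i) - 1) + strict_lower M"
  proof (rule eq_matI)
    fix i j assume "i < dim_row (mat_diag n (\<lambda>i. K $$ (i, i) - 1) + strict_lower M)"
      "j < dim_col (mat_diag n (\<lambda>i. K $$ (i, i) - 1) + strict_lower M)"
    then have ij: "i < n" "j < n" using Mc by (auto simp: strict_lower_def)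
    have "K $$ (i, j) = J $$ (j, i) + M $$ (i, j)"
      using arg_cong[OF KM, of "\<lambda>X. X $$ (i, j)"] ij Jc Mc by simp
    then show "(K - 1\<^sub>m n) $$ (i, j) = (mat_diag n (\<lambda>i. K $$ (i, i) - 1) + strict_lower M) $$ (i, j)"
      using ij K J Kc Mc
      by (cases i j rule: linorder_cases) (auto simp: strict_lower_def mat_diag_def lower_pos_def)
  qed (use Kc Mc in \<open>auto simp: strict_lower_def mat_diag_def\<close>)
  moreover have "norm_bound (mat_diag n (\<lambda>i. K $$ (i, i) - 1) + strict_lower M) (\<eta> + real k * \<eta>)"
  proof (rule norm_bound_add[of _ n n])
    show "norm_bound (mat_diag n (\<lambda>i. K $$ (i, i) - 1)) \<eta>"
      using diag norm_bound_nonneg[OF eta] by (intro norm_bound_mat_diag)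
    show "norm_bound (strict_lower M) (real k * \<eta>)"
      by (rule norm_bound_strict_lower[OF Mc Meta k])
  qed (use Mc in \<open>auto simp: strict_lower_def\<close>)
  ultimately show ?thesis
    by (simp add: algebra_simps)
qed

section \<open>Matrices diagonalized by an orthogonal basis\<close>

lemma orthonormal_matD:
  assumes "orthonormal_mat V" "V \<in> carrier_mat n n"
  shows "transpose_mat V * V = 1\<^sub>m n" "V * transpose_mat V = 1\<^sub>m n"
  using assms by (auto simp: orthonormal_mat_def)

lemmas square_mat_simps =
  assoc_mult_mat[of _ n n _ n _ n] mult_carrier_mat[of _ n n _ n] transpose_mult[of _ n n _ n]
  assoc_mult_mat_vec[of _ n n _ n] mult_mat_vec_carrier[of _ n n] for n

lemma dim_mat_diag [simp]: "dim_row (mat_diag n d) = n" "dim_col (mat_diag n d) = n"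
  by (simp_all add: mat_diag_def)

text \<open>For orthogonal \<open>V\<close> these matrices form a commutative algebra in which one
  computes entrywise with the eigenvalues \<open>d\<close>. It contains \<open>C^T C\<close>, its
  truncation, the discarded part and the symmetric roots.\<close>

definition conj_diag :: "nat \<Rightarrow> real mat \<Rightarrow> (nat \<Rightarrow> real) \<Rightarrow> real mat" where
  "conj_diag n V d = V * mat_diag n d * transpose_mat V"

context
  fixes n :: nat and V :: "real mat"
  assumes orth: "orthonormal_mat V" and V: "V \<in> carrier_mat n n"
begin

lemma conj_diag_carrier: "conj_diag n V d \<in> carrier_mat n n"
  using V by (intro carrier_matI) (simp_all add: conj_diag_def)

lemma conj_diag_mult: "conj_diag n V d * conj_diag n V e = conj_diag n V (\<lambda>i. d i * e i)"
proof -
  have "conj_diag n V d * conj_diag n V e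
      = V * mat_diag n d * (transpose_mat V * V) * mat_diag n e * transpose_mat V"
    using V by (simp add: conj_diag_def square_mat_simps[where n = n])
  also have "\<dots> = V * (mat_diag n d * mat_diag n e) * transpose_mat V"
    using V orthonormal_matD[OF orth V] by (simp add: square_mat_simps[where n = n] del: mat_diag_diag)
  finally show ?thesis
    by (simp add: conj_diag_def)
qed

lemma conj_diag_one: "conj_diag n V (\<lambda>_. 1) = 1\<^sub>m n"
  using V orthonormal_matD[OF orth V] by (simp add: conj_diag_def)

lemma conj_diag_add: "conj_diag n V d + conj_diag n V e = conj_diag n V (\<lambda>i. d i + e i)"
proof -
  have "mat_diag n (\<lambda>i. d i + e i) = mat_diag n d + mat_diag n e"
    by (intro eq_matI) (auto simp: mat_diag_def)
  then show ?thesis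
    using V by (simp add: conj_diag_def mult_add_distrib_mat[of _ n n _ n] add_mult_distrib_mat[of _ n n _ _ n])
qed

lemma conj_diag_minus: "conj_diag n V d - conj_diag n V e = conj_diag n V (\<lambda>i. d i - e i)"
proof -
  have "mat_diag n (\<lambda>i. d i - e i) = mat_diag n d - mat_diag n e"
    by (intro eq_matI) (auto simp: mat_diag_def)
  then show ?thesis
    using V by (simp add: conj_diag_def mult_minus_distrib_mat[of _ n n _ n] minus_mult_distrib_mat[of _ n n _ _ n])
qed

lemma transpose_conj_diag: "transpose_mat (conj_diag n V d) = conj_diag n V d"
proof -
  have "transpose_mat (mat_diag n d) = mat_diag n d"
    by (intro eq_matI) (auto simp: mat_diag_def)
  then show ?thesis
    using V by (simp add: conj_diag_def square_mat_simps[where n = n])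
qed

lemma conj_diag_cong: "(\<And>i. i < n \<Longrightarrow> d i = e i) \<Longrightarrow> conj_diag n V d = conj_diag n V e"
  unfolding conj_diag_def mat_diag_def
  by (intro arg_cong2[where f = "(*)"] refl eq_matI) auto

lemma vec_norm2_transpose_orthonormal:
  assumes "x \<in> carrier_vec n"
  shows "vec_norm2 (transpose_mat V *\<^sub>v x) = vec_norm2 x"
proof -
  have "(vec_norm2 (transpose_mat V *\<^sub>v x))\<^sup>2 = (vec_norm2 x)\<^sup>2"
    using vec_norm2_transpose_mult_square[OF V assms] orthonormal_matD[OF orth V] assms
    by (simp add: vec_norm2_square)
  then show ?thesis by simp
qed

lemma conj_diag_quadratic:
  assumes x: "x \<in> carrier_vec n"
  shows "x \<bullet> (conj_diag n V d *\<^sub>v x) = (\<Sum>i<n. d i * ((transpose_mat V *\<^sub>v x) $ i)\<^sup>2)"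
proof -
  let ?y = "transpose_mat V *\<^sub>v x"
  have y: "?y \<in> carrier_vec n" using V x by simp
  have "x \<bullet> (conj_diag n V d *\<^sub>v x) = x \<bullet> (V *\<^sub>v (mat_diag n d *\<^sub>v ?y))"
    using V x by (simp add: conj_diag_def square_mat_simps[where n = n])
  also have "\<dots> = ?y \<bullet> (mat_diag n d *\<^sub>v ?y)"
    using y x by (intro transpose_vec_mult_scalar[OF V, symmetric]) (simp_all add: square_mat_simps[where n = n])
  also have "\<dots> = (\<Sum>i<n. d i * (?y $ i)\<^sup>2)"
    using y V by (simp add: mat_diag_mult_vec scalar_prod_def lessThan_atLeast0 power2_eq_square mult_ac)
  finally show ?thesis .
qed

lemma sum_transpose_orthonormal_square:
  assumes x: "x \<in> carrier_vec n"
  shows "(\<Sum>i<n. ((transpose_mat V *\<^sub>v x) $ i)\<^sup>2) = (vec_norm2 x)\<^sup>2"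
  unfolding vec_norm2_transpose_orthonormal[OF x, symmetric] using V x
  by (simp add: vec_norm2_conv_sum sum_nonneg)

lemma conj_diag_quadratic_ge:
  assumes x: "x \<in> carrier_vec n" and "\<And>i. i < n \<Longrightarrow> a \<le> d i"
  shows "a * (vec_norm2 x)\<^sup>2 \<le> x \<bullet> (conj_diag n V d *\<^sub>v x)"
  unfolding conj_diag_quadratic[OF x] sum_transpose_orthonormal_square[OF x, symmetric]
    sum_distrib_left
  using assms(2) by (intro sum_mono mult_right_mono) auto

lemma conj_diag_quadratic_le:
  assumes x: "x \<in> carrier_vec n" and "\<And>i. i < n \<Longrightarrow> d i \<le> b"
  shows "x \<bullet> (conj_diag n V d *\<^sub>v x) \<le> b * (vec_norm2 x)\<^sup>2"
  unfolding conj_diag_quadratic[OF x] sum_transpose_orthonormal_square[OF x, symmetric]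
    sum_distrib_left
  using assms(2) by (intro sum_mono mult_right_mono) auto

lemma norm_bound_conj_diag:
  assumes "b \<ge> 0" "\<And>i. i < n \<Longrightarrow> \<bar>d i\<bar> \<le> b"
  shows "norm_bound (conj_diag n V d) b"
proof -
  have Vt: "norm_bound (transpose_mat V) 1"
    using V by (intro norm_boundI[of _ _ n n]) (simp_all add: vec_norm2_transpose_orthonormal)
  then have V1: "norm_bound V 1"
    using norm_bound_transpose[of "transpose_mat V" n n 1] V by simp
  have "norm_bound (conj_diag n V d) (1 * b * 1)"
    unfolding conj_diag_def using V
    by (intro norm_bound_mult[of _ n n _ n] V1 Vt norm_bound_mat_diag assms) auto
  then show ?thesis by simp
qed

lemma conj_diag_mult_col:
  assumes j: "j < n"
  shows "conj_diag n V d *\<^sub>v col V j = d j \<cdot>\<^sub>v col V j"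
proof -
  have "transpose_mat V *\<^sub>v col V j = col (transpose_mat V * V) j"
    using V j by (intro col_mult2[symmetric]) auto
  also have "\<dots> = unit_vec n j"
    using orthonormal_matD[OF orth V] j by simp
  finally have "conj_diag n V d *\<^sub>v col V j = V *\<^sub>v (mat_diag n d *\<^sub>v unit_vec n j)"
    using V by (simp add: conj_diag_def square_mat_simps[where n = n] col_carrier_vec[OF j])
  also have "mat_diag n d *\<^sub>v unit_vec n j = d j \<cdot>\<^sub>v unit_vec n j"
    using j by (intro eq_vecI) (auto simp: mat_diag_mult_vec)
  also have "V *\<^sub>v \<dots> = d j \<cdot>\<^sub>v (V *\<^sub>v unit_vec n j)"
    using V by (intro mult_mat_vec) auto
  also have "V *\<^sub>v unit_vec n j = col V j"
    using V j by (intro eq_vecI) auto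
  finally show ?thesis .
qed

text \<open>A positive semidefinite root \<open>T\<close> of a matrix with eigenpair \<open>(s\<^sup>2, v)\<close>, \<open>s > 0\<close>, has
  eigenpair \<open>(s, v)\<close>, since \<open>(T + s I) (T - s I) v = 0\<close> and \<open>T + s I\<close> is positive definite.\<close>

lemma psd_sqrt_conj_diag:
  assumes s: "\<And>i. i < n \<Longrightarrow> 0 < s i"
  shows "psd_sqrt (conj_diag n V (\<lambda>i. (s i)\<^sup>2)) = conj_diag n V s"
  unfolding psd_sqrt_def
proof (rule the_equality)
  have "x \<bullet> (conj_diag n V s *\<^sub>v x) \<ge> 0" if "x \<in> carrier_vec n" for x
    using conj_diag_quadratic_ge[OF that, of 0 s] s by (simp add: less_imp_le)
  then show "sym_pos_semidef (conj_diag n V s) \<and>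
      conj_diag n V s * conj_diag n V s = conj_diag n V (\<lambda>i. (s i)\<^sup>2)"
    using conj_diag_carrier[of s]
    by (auto simp: sym_pos_semidef_def transpose_conj_diag conj_diag_mult power2_eq_square)
next
  fix T assume "sym_pos_semidef T \<and> T * T = conj_diag n V (\<lambda>i. (s i)\<^sup>2)"
  then have psd: "sym_pos_semidef T" and TT: "T * T = conj_diag n V (\<lambda>i. (s i)\<^sup>2)"
    by auto
  have "dim_row T = n"
    using arg_cong[OF TT, of dim_row] by (simp add: carrier_matD(1)[OF conj_diag_carrier])
  then have T: "T \<in> carrier_mat n n"
    using psd by (auto simp: sym_pos_semidef_def)
  have Tv: "T *\<^sub>v col V j = s j \<cdot>\<^sub>v col V j" if j: "j < n" for j
  proof -
    let ?v = "col V j"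
    define w where "w = T *\<^sub>v ?v - s j \<cdot>\<^sub>v ?v"
    have v: "?v \<in> carrier_vec n" using V j by simp
    have w: "w \<in> carrier_vec n" using T v by (simp add: w_def)
    have "T *\<^sub>v w = T *\<^sub>v (T *\<^sub>v ?v) - s j \<cdot>\<^sub>v (T *\<^sub>v ?v)"
      using T v by (simp add: w_def mult_minus_distrib_mat_vec[of _ n n] mult_mat_vec[of _ n n])
    also have "T *\<^sub>v (T *\<^sub>v ?v) = (s j)\<^sup>2 \<cdot>\<^sub>v ?v"
      using T v conj_diag_mult_col[OF j, of "\<lambda>i. (s i)\<^sup>2"] by (simp add: TT flip: assoc_mult_mat_vec[of _ n n _ n])
    also have "(s j)\<^sup>2 \<cdot>\<^sub>v ?v - s j \<cdot>\<^sub>v (T *\<^sub>v ?v) = (- s j) \<cdot>\<^sub>v w"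
      using T V by (intro eq_vecI) (auto simp: w_def algebra_simps power2_eq_square)
    finally have "T *\<^sub>v w = (- s j) \<cdot>\<^sub>v w" .
    then have "w \<bullet> (T *\<^sub>v w) = - s j * (vec_norm2 w)\<^sup>2"
      using w by (simp add: vec_norm2_square)
    moreover have "0 \<le> w \<bullet> (T *\<^sub>v w)"
      using psd T w by (auto simp: sym_pos_semidef_def)
    ultimately have "vec_norm2 w = 0"
      using s[OF j] by (simp add: mult_le_0_iff)
    then have "w = 0\<^sub>v n" using vec_norm2_eq_0_iff[OF w] by simp
    then have "w $ i = 0" if "i < n" for i using that by simp
    then show ?thesis
      using T V by (intro eq_vecI) (auto simp: w_def)
  qed
  \<comment> \<open>Taken together, the eigenpairs determine \<open>T\<close>, because
    \<open>V\<close> is invertible.\<close>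
  have "T * V = V * mat_diag n s"
  proof (rule eq_matI)
    fix i j assume "i < dim_row (V * mat_diag n s)" "j < dim_col (V * mat_diag n s)"
    then have ij: "i < n" "j < n" using V by (auto simp: mat_diag_def)
    have "(T * V) $$ (i, j) = (T *\<^sub>v col V j) $ i"
      using ij T V by simp
    then show "(T * V) $$ (i, j) = (V * mat_diag n s) $$ (i, j)"
      using Tv[OF ij(2)] ij V by (simp add: mat_diag_mult_right)
  qed (use T V in \<open>auto simp: mat_diag_def\<close>)
  then have "T * V * transpose_mat V = conj_diag n V s"
    by (simp add: conj_diag_def)
  then show "T = conj_diag n V s"
    using T V orthonormal_matD[OF orth V] by (simp add: assoc_mult_mat[of _ n n _ n _ n])
qed

end

text \<open>Dropping columns of \<open>V\<close> amounts to setting their eigenvalues to zero. This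
  brings the truncated matrix into the same algebra as \<open>C^T C\<close>.\<close>

lemma conj_diag_truncate:
  assumes V: "V \<in> carrier_mat n n" and r: "r \<le> n"
  shows "mat n r (\<lambda>(i, j). V $$ (i, j)) * mat_diag r d * transpose_mat (mat n r (\<lambda>(i, j). V $$ (i, j)))
    = conj_diag n V (\<lambda>i. if i < r then d i else 0)" (is "?W * _ * _ = _")
proof (rule eq_matI)
  fix i j assume "i < dim_row (conj_diag n V (\<lambda>i. if i < r then d i else 0))"
    "j < dim_col (conj_diag n V (\<lambda>i. if i < r then d i else 0))"
  then have ij: "i < n" "j < n" using V by (auto simp: conj_diag_def)
  have W: "?W \<in> carrier_mat n r" by simp
  have "(?W * mat_diag r d * transpose_mat ?W) $$ (i, j) = (\<Sum>k<r. V $$ (i, k) * d k * V $$ (j, k))"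
    unfolding mat_diag_mult_right[OF W]
    using ij by (subst index_mult_mat_sum[of _ n r _ n]) (auto intro!: sum.cong)
  also have "\<dots> = (\<Sum>k<n. V $$ (i, k) * (if k < r then d k else 0) * V $$ (j, k))"
    using r by (intro sum.mono_neutral_cong_left) auto
  also have "\<dots> = conj_diag n V (\<lambda>i. if i < r then d i else 0) $$ (i, j)"
    unfolding conj_diag_def mat_diag_mult_right[OF V]
    using ij V by (subst index_mult_mat_sum[of _ n n _ n]) (auto intro!: sum.cong)
  finally show "(?W * mat_diag r d * transpose_mat ?W) $$ (i, j)
    = conj_diag n V (\<lambda>i. if i < r then d i else 0) $$ (i, j)" .
qed (use V in \<open>auto simp: conj_diag_def\<close>)

text \<open>If \<open>n > m\<close>, the columns of \<open>S\<close> from index \<open>m\<close> on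
  are zero and \<open>S $$ (i, i)\<close> lies outside the matrix there; hence the padding with
  zeros.\<close>

lemma svd_gram_diag:
  fixes S :: "real mat"
  assumes S: "S \<in> carrier_mat m n" "diagonal_mat S"
  shows "transpose_mat S * S = mat_diag n (\<lambda>i. (if i < m then S $$ (i, i) else 0)\<^sup>2)"
proof (rule eq_matI)
  fix i j assume "i < dim_row (mat_diag n (\<lambda>i. (if i < m then S $$ (i, i) else 0)\<^sup>2))"
    "j < dim_col (mat_diag n (\<lambda>i. (if i < m then S $$ (i, i) else 0)\<^sup>2))"
  then have ij: "i < n" "j < n" by (auto simp: mat_diag_def)
  have "(transpose_mat S * S) $$ (i, j) = (\<Sum>k<m. S $$ (k, i) * S $$ (k, j))"
    using ij S by (subst index_mult_mat_sum[of _ n m _ n]) auto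
  also have "\<dots> = (\<Sum>k<m. if k = i then S $$ (k, i) * S $$ (k, j) else 0)"
    using S ij by (intro sum.cong) (auto simp: diagonal_mat_def)
  also have "\<dots> = (if i < m then S $$ (i, i) * S $$ (i, j) else 0)"
    by simp
  also have "\<dots> = mat_diag n (\<lambda>i. (if i < m then S $$ (i, i) else 0)\<^sup>2) $$ (i, j)"
    using S ij by (auto simp: diagonal_mat_def mat_diag_def power2_eq_square)
  finally show "(transpose_mat S * S) $$ (i, j)
    = mat_diag n (\<lambda>i. (if i < m then S $$ (i, i) else 0)\<^sup>2) $$ (i, j)" .
qed (use S in \<open>auto simp: mat_diag_def\<close>)

text \<open>The left singular vectors cancel through \<open>U^T U = I\<close>. The second identity
  is for the matrix under the symmetric root.\<close>

lemma full_svd_gram: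
  assumes svd: "full_svd C U Sg V" and C: "C \<in> carrier_mat m n"
  shows "transpose_mat C * C = conj_diag n V (\<lambda>i. (if i < m then Sg $$ (i, i) else 0)\<^sup>2)"
    and "V * transpose_mat Sg * Sg * transpose_mat V
      = conj_diag n V (\<lambda>i. (if i < m then Sg $$ (i, i) else 0)\<^sup>2)"
proof -
  have c: "U \<in> carrier_mat m m" "V \<in> carrier_mat n n" "Sg \<in> carrier_mat m n"
    and U: "orthonormal_mat U" and diag: "diagonal_mat Sg" and Ceq: "C = U * Sg * transpose_mat V"
    using svd C by (auto simp: full_svd_def)
  note rect = assoc_mult_mat[of _ n m _ n _ n] assoc_mult_mat[of _ n n _ m _ n]
    assoc_mult_mat[of _ m m _ n _ n] assoc_mult_mat[of _ n m _ m _ n] assoc_mult_mat[of _ n n _ n _ n]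
    assoc_mult_mat[of _ m m _ m _ n]
    mult_carrier_mat[of _ n m _ n] mult_carrier_mat[of _ n n _ m] mult_carrier_mat[of _ n n _ n]
    mult_carrier_mat[of _ m n _ n] mult_carrier_mat[of _ m m _ n] mult_carrier_mat[of _ n m _ m]
  have "V * transpose_mat Sg * Sg * transpose_mat V = V * (transpose_mat Sg * Sg) * transpose_mat V"
    using c by (simp add: rect)
  then show 1: "V * transpose_mat Sg * Sg * transpose_mat V
      = conj_diag n V (\<lambda>i. (if i < m then Sg $$ (i, i) else 0)\<^sup>2)"
    unfolding conj_diag_def svd_gram_diag[OF c(3) diag] .
  have "transpose_mat C = V * (transpose_mat Sg * transpose_mat U)"
    using c by (simp add: Ceq transpose_mult[of _ m n _ n] transpose_mult[of _ m m _ n] rect)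
  then have "transpose_mat C * C
      = V * (transpose_mat Sg * (transpose_mat U * (U * (Sg * transpose_mat V))))"
    using c by (simp add: Ceq rect)
  also have "transpose_mat U * (U * (Sg * transpose_mat V)) = Sg * transpose_mat V"
    using c orthonormal_matD[OF U]
    by (simp add: mult_carrier_mat[of _ m n _ n] flip: assoc_mult_mat[of _ m m _ m _ n])
  also have "V * (transpose_mat Sg * (Sg * transpose_mat V)) = V * transpose_mat Sg * Sg * transpose_mat V"
    using c by (simp add: rect)
  finally show "transpose_mat C * C = conj_diag n V (\<lambda>i. (if i < m then Sg $$ (i, i) else 0)\<^sup>2)"
    using 1 by simp
qed

section \<open>Block factorizations\<close>

lemma four_block_mat_eqD:
  assumes "four_block_mat A B C D = four_block_mat A' B' C' D'"
    and "A \<in> carrier_mat m m" "B \<in> carrier_mat m n" "C \<in> carrier_mat n m" "D \<in> carrier_mat n n"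
    and "A' \<in> carrier_mat m m" "B' \<in> carrier_mat m n" "C' \<in> carrier_mat n m" "D' \<in> carrier_mat n n"
  shows "A = A'" "B = B'" "C = C'" "D = D'"
proof -
  have eq: "four_block_mat A B C D $$ (i, j) = four_block_mat A' B' C' D' $$ (i, j)" for i j
    using assms(1) by simp
  show "A = A'"
  proof (rule eq_matI)
    fix i j assume "i < dim_row A'" "j < dim_col A'"
    then show "A $$ (i, j) = A' $$ (i, j)" using eq[of i j] assms(2-) by simp
  qed (use assms(2-) in auto)
  show "B = B'"
  proof (rule eq_matI)
    fix i j assume "i < dim_row B'" "j < dim_col B'"
    then show "B $$ (i, j) = B' $$ (i, j)" using eq[of i "m + j"] assms(2-) by simp
  qed (use assms(2-) in auto)
  show "C = C'"
  proof (rule eq_matI)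
    fix i j assume "i < dim_row C'" "j < dim_col C'"
    then show "C $$ (i, j) = C' $$ (i, j)" using eq[of "m + i" j] assms(2-) by simp
  qed (use assms(2-) in auto)
  show "D = D'"
  proof (rule eq_matI)
    fix i j assume "i < dim_row D'" "j < dim_col D'"
    then show "D $$ (i, j) = D' $$ (i, j)" using eq[of "m + i" "m + j"] assms(2-) by simp
  qed (use assms(2-) in auto)
qed

lemma lower_block_gram:
  fixes P X Y :: "real mat"
  assumes "P \<in> carrier_mat m m" "X \<in> carrier_mat n m" "Y \<in> carrier_mat n n"
  shows "four_block_mat P (0\<^sub>m m n) X Y * transpose_mat (four_block_mat P (0\<^sub>m m n) X Y)
    = four_block_mat (P * transpose_mat P) (P * transpose_mat X)
        (X * transpose_mat P) (X * transpose_mat X + Y * transpose_mat Y)"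
  using assms
  by (subst transpose_four_block_mat[of _ m m _ n _ n], simp_all)
    (subst mult_four_block_mat[of _ m m _ n _ n _ _ m _ n], auto)

text \<open>In a quadratic form, a vector supported on the last \<open>n\<close> coordinates sees
  only the lower right block. Both bounds on \<open>L2\<close> below rest on this
  compression.\<close>

lemma vec_norm2_block_transpose:
  fixes M A12 A21 :: "real mat"
  assumes A: "A11 \<in> carrier_mat m m" "A12 \<in> carrier_mat m n" "A21 \<in> carrier_mat n m"
    and L2: "L2 \<in> carrier_mat n n" and x: "x \<in> carrier_vec n"
  shows "(0\<^sub>v m @\<^sub>v x) \<bullet> (four_block_mat A11 A12 A21 (L2 * transpose_mat L2) *\<^sub>v (0\<^sub>v m @\<^sub>v x))
    = (vec_norm2 (transpose_mat L2 *\<^sub>v x))\<^sup>2"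
proof -
  have L22: "L2 * transpose_mat L2 \<in> carrier_mat n n"
    by (rule mult_carrier_mat[OF L2]) (simp add: L2)
  have "four_block_mat A11 A12 A21 (L2 * transpose_mat L2) *\<^sub>v (0\<^sub>v m @\<^sub>v x)
      = (A11 *\<^sub>v 0\<^sub>v m + A12 *\<^sub>v x) @\<^sub>v (A21 *\<^sub>v 0\<^sub>v m + L2 * transpose_mat L2 *\<^sub>v x)"
    by (rule four_block_mat_mult_vec[OF A L22 _ x]) simp
  also have "A21 *\<^sub>v 0\<^sub>v m = 0\<^sub>v n"
    using A by (intro eq_vecI) auto
  finally have "four_block_mat A11 A12 A21 (L2 * transpose_mat L2) *\<^sub>v (0\<^sub>v m @\<^sub>v x)
      = (A11 *\<^sub>v 0\<^sub>v m + A12 *\<^sub>v x) @\<^sub>v (L2 * transpose_mat L2 *\<^sub>v x)"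
    using L22 x by (simp add: mult_mat_vec_carrier[of _ n n])
  then show ?thesis
    unfolding vec_norm2_transpose_mult_square[OF L2 x] using A L22 x
    by (simp add: scalar_prod_append[of _ m _ n] mult_mat_vec_carrier[of _ n n]
        mult_mat_vec_carrier[of _ m n] mult_mat_vec_carrier[of _ m m])
qed

text \<open>The factor \<open>M\<close> may have any shape, so the bound serves the triangular
  factor of the block matrix as well as the one built with a symmetric root.\<close>

lemma norm_bound_gram_block:
  assumes A: "A11 \<in> carrier_mat m m" "A12 \<in> carrier_mat m n" "A21 \<in> carrier_mat n m"
    and L2: "L2 \<in> carrier_mat n n" and M: "M \<in> carrier_mat (m + n) (m + n)"
    and eq: "M * transpose_mat M = four_block_mat A11 A12 A21 (L2 * transpose_mat L2)"
    and b: "norm_bound M b"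
  shows "norm_bound L2 b"
proof -
  have "norm_bound (transpose_mat L2) b"
  proof (rule norm_boundI[OF norm_bound_nonneg[OF b]])
    fix x :: "real vec" assume x: "x \<in> carrier_vec n"
    let ?y = "0\<^sub>v m @\<^sub>v x"
    have y: "?y \<in> carrier_vec (m + n)" using x by simp
    have "(vec_norm2 (transpose_mat L2 *\<^sub>v x))\<^sup>2 = (vec_norm2 (transpose_mat M *\<^sub>v ?y))\<^sup>2"
      unfolding vec_norm2_transpose_mult_square[OF M y] eq vec_norm2_block_transpose[OF A L2 x] ..
    then have "vec_norm2 (transpose_mat L2 *\<^sub>v x) = vec_norm2 (transpose_mat M *\<^sub>v ?y)"
      by simp
    also have "\<dots> \<le> b * vec_norm2 ?y"
      using norm_boundD[OF norm_bound_transpose[OF M b] _ y] M by simp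
    finally show "vec_norm2 (transpose_mat L2 *\<^sub>v x) \<le> b * vec_norm2 x"
      using x by (simp add: vec_norm2_append_zero[of _ n])
  qed (use L2 in simp)
  then show ?thesis
    using norm_bound_transpose[of "transpose_mat L2" n n b] L2 by simp
qed

text \<open>The squared norm of \<open>L2^T x\<close> is a value of the quadratic form of the whole
  block matrix, hence at most \<open>b\<close> times the squared norm of \<open>x\<close>.\<close>

lemma norm_bound_block_sqrt:
  assumes A: "A11 \<in> carrier_mat m m" "A12 \<in> carrier_mat m n" "A21 \<in> carrier_mat n m"
    and L2: "L2 \<in> carrier_mat n n"
    and b: "norm_bound (four_block_mat A11 A12 A21 (L2 * transpose_mat L2)) b"
  shows "norm_bound L2 (sqrt b)"
proof -
  let ?A = "four_block_mat A11 A12 A21 (L2 * transpose_mat L2)"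
  have Ac: "?A \<in> carrier_mat (m + n) (m + n)"
    using A L2 by (intro four_block_carrier_mat mult_carrier_mat[of _ n n]) auto
  have b0: "b \<ge> 0" using norm_bound_nonneg[OF b] .
  have "norm_bound (transpose_mat L2) (sqrt b)"
  proof (rule norm_boundI)
    fix x :: "real vec" assume x: "x \<in> carrier_vec n"
    let ?y = "0\<^sub>v m @\<^sub>v x"
    have y: "?y \<in> carrier_vec (m + n)" using x by simp
    have "(vec_norm2 (transpose_mat L2 *\<^sub>v x))\<^sup>2 = ?y \<bullet> (?A *\<^sub>v ?y)"
      by (rule vec_norm2_block_transpose[OF A L2 x, symmetric])
    also have "\<dots> \<le> vec_norm2 ?y * vec_norm2 (?A *\<^sub>v ?y)"
      using scalar_prod_le_vec_norm2[OF y mult_mat_vec_carrier[OF Ac y]] by simp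
    also have "\<dots> \<le> vec_norm2 ?y * (b * vec_norm2 ?y)"
      using norm_boundD[OF b Ac y] by (intro mult_left_mono) auto
    also have "\<dots> = (sqrt b * vec_norm2 x)\<^sup>2"
      using x b0 by (simp add: vec_norm2_append_zero[of _ n] power2_eq_square algebra_simps)
    finally show "vec_norm2 (transpose_mat L2 *\<^sub>v x) \<le> sqrt b * vec_norm2 x"
      by (rule power2_le_imp_le) (simp add: b0)
  qed (use L2 b0 in auto)
  then show ?thesis
    using norm_bound_transpose[of "transpose_mat L2" n n "sqrt b"] L2 by simp
qed

text \<open>The difference is \<open>D (K - I)\<close>, where \<open>K = D^-1 D'\<close> is the
  Cholesky factor of \<open>I + G\<close> with \<open>G = D^-1 F D^-T\<close>. In the bound,
  \<open>h\<close> stands for \<open>D\<close>, \<open>g * f * g\<close> for \<open>G\<close>, and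
  \<open>1 + real k\<close> for the truncation.\<close>

lemma norm_bound_cholesky_diff:
  assumes D: "lower_pos n D" and D': "lower_pos n D'" and F: "F \<in> carrier_mat n n"
    and eq: "D' * transpose_mat D' = D * transpose_mat D + F"
    and psd: "\<And>x. x \<in> carrier_vec n \<Longrightarrow> 0 \<le> x \<bullet> (F *\<^sub>v x)"
    and f: "norm_bound F f" and g: "norm_bound (mat_inv D) g" and h: "norm_bound D h"
    and k: "n \<le> 2 ^ k"
  shows "norm_bound (D' - D) (h * ((1 + real k) * (g * f * g)))"
proof -
  define J where "J = mat_inv D"
  note c = lower_pos_carrier[OF D] lower_pos_carrier[OF D'] lower_pos_mat_inv(1)[OF D, folded J_def] F
  have DJ: "D * J = 1\<^sub>m n" "J * D = 1\<^sub>m n" "transpose_mat D * transpose_mat J = 1\<^sub>m n"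
    unfolding J_def by (simp_all add: lower_pos_mat_inv[OF D] transpose_mat_inv_cancel[OF D])
  define K where "K = J * D'"
  define G where "G = J * F * transpose_mat J"
  have Jt: "transpose_mat J \<in> carrier_mat n n" using c by simp
  have K: "K \<in> carrier_mat n n" using c by (simp add: K_def)
  have JF: "J * F \<in> carrier_mat n n" using c by simp
  have G: "G \<in> carrier_mat n n" unfolding G_def by (rule mult_carrier_mat[OF JF Jt])
  have "D * K = D * J * D'"
    using c by (simp add: K_def square_mat_simps[where n = n])
  then have DK: "D * K = D'"
    using c DJ by simp
  then have Kl: "lower_pos n K"
    using lower_pos_left_quotient(1)[OF D K] D' by simp
  have "K * transpose_mat K = J * (D' * transpose_mat D') * transpose_mat J"
    using c by (simp add: K_def square_mat_simps[where n = n])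
  also have "\<dots> = (J * D) * (transpose_mat D * transpose_mat J) + G"
    unfolding eq using c
    by (simp add: G_def square_mat_simps[where n = n] mult_add_distrib_mat[of _ n n _ n]
        add_mult_distrib_mat[of _ n n _ _ n])
  finally have KK: "K * transpose_mat K = 1\<^sub>m n + G"
    by (simp add: DJ)
  have Gpsd: "0 \<le> x \<bullet> (G *\<^sub>v x)" if x: "x \<in> carrier_vec n" for x
  proof -
    let ?y = "transpose_mat J *\<^sub>v x"
    have y: "?y \<in> carrier_vec n" using c x by simp
    have "x \<bullet> (G *\<^sub>v x) = x \<bullet> (J *\<^sub>v (F *\<^sub>v ?y))"
      using c x by (simp add: G_def square_mat_simps[where n = n])
    also have "\<dots> = ?y \<bullet> (F *\<^sub>v ?y)"
      using c x y by (intro transpose_vec_mult_scalar[OF c(3), symmetric]) auto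
    finally show ?thesis using psd[OF y] by simp
  qed
  have Gn: "norm_bound G (g * f * g)"
    unfolding G_def using g[folded J_def] c
    by (intro norm_bound_mult[of _ n n _ n] JF Jt f norm_bound_transpose[of _ n n]) auto
  have "norm_bound (D * (K - 1\<^sub>m n)) (h * ((1 + real k) * (g * f * g)))"
    using c K
    by (intro norm_bound_mult[of _ n n _ n] h norm_bound_cholesky_minus_one[OF Kl G KK Gpsd Gn k]) auto
  also have "D * (K - 1\<^sub>m n) = D' - D"
    using c K DK by (simp add: mult_minus_distrib_mat[of _ n n _ n])
  finally show ?thesis .
qed

lemma lower_pos_block_decomp:
  assumes L: "lower_pos (m + n) L"
  obtains P X Y where "lower_pos m P" "X \<in> carrier_mat n m" "lower_pos n Y"
    "L = four_block_mat P (0\<^sub>m m n) X Y"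
proof
  let ?P = "mat m m (\<lambda>(i, j). L $$ (i, j))" and ?X = "mat n m (\<lambda>(i, j). L $$ (m + i, j))"
    and ?Y = "mat n n (\<lambda>(i, j). L $$ (m + i, m + j))"
  show "lower_pos m ?P" "?X \<in> carrier_mat n m" "lower_pos n ?Y"
    using L by (auto simp: lower_pos_def)
  show "L = four_block_mat ?P (0\<^sub>m m n) ?X ?Y"
    using L by (intro eq_matI) (auto simp: lower_pos_def)
qed

text \<open>This is the lower right block of the Gram matrices in question. \<open>W\<close> is left
  free to cover triangular factors and symmetric roots at once.\<close>

lemma corner_gram:
  fixes C L2 W :: "real mat"
  assumes "C \<in> carrier_mat m n" "L2 \<in> carrier_mat n n" "W \<in> carrier_mat n n"
  shows "L2 * transpose_mat C * transpose_mat (L2 * transpose_mat C) + L2 * W * transpose_mat (L2 * W)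
    = L2 * (transpose_mat C * C + W * transpose_mat W) * transpose_mat L2"
proof -
  have Ct: "transpose_mat C \<in> carrier_mat n m" using assms(1) by simp
  have CC: "transpose_mat C * C \<in> carrier_mat n n" by (rule mult_carrier_mat[OF Ct assms(1)])
  have "L2 * transpose_mat C * transpose_mat (L2 * transpose_mat C)
      = L2 * (transpose_mat C * C) * transpose_mat L2"
    using assms Ct CC
    by (simp add: transpose_mult[of _ n n _ m] assoc_mult_mat[of _ n n _ m _ n]
        assoc_mult_mat[of _ n m _ n _ n] assoc_mult_mat[of _ n n _ n _ n]
        mult_carrier_mat[of _ m n _ n])
  moreover have "L2 * W * transpose_mat (L2 * W) = L2 * (W * transpose_mat W) * transpose_mat L2"
    using assms by (simp add: square_mat_simps[where n = n])
  ultimately show ?thesis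
    using assms CC by (simp add: square_mat_simps[where n = n] mult_add_distrib_mat[of _ n n _ n]
        add_mult_distrib_mat[of _ n n _ _ n])
qed

text \<open>Comparison of blocks: the first gives \<open>P = L1\<close> by uniqueness, the
  off-diagonal one gives \<open>X\<close> by cancelling \<open>L1\<close>, and the last leaves
  \<open>Y Y^T = L2 (I - C^T C) L2^T\<close>. Then \<open>D = L2^-1 Y\<close> is a triangular
  quotient.\<close>

lemma block_cholesky:
  assumes L1: "lower_pos m L1" and L2: "lower_pos n L2" and A12: "A12 \<in> carrier_mat m n"
    and C: "C = mat_inv L1 * A12 * transpose_mat (mat_inv L2)"
    and L: "lower_pos (m + n) L"
    and eq: "L * transpose_mat L
      = four_block_mat (L1 * transpose_mat L1) A12 (transpose_mat A12) (L2 * transpose_mat L2)"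
  obtains D where "lower_pos n D" "transpose_mat C * C + D * transpose_mat D = 1\<^sub>m n"
    "L = four_block_mat L1 (0\<^sub>m m n) (L2 * transpose_mat C) (L2 * D)"
    "L1 * transpose_mat (L2 * transpose_mat C) = A12"
proof -
  note c1 = lower_pos_carrier[OF L1] and c2 = lower_pos_carrier[OF L2]
  note inv1 = lower_pos_mat_inv[OF L1] and inv2 = lower_pos_mat_inv[OF L2]
  note tinv2 = transpose_mat_inv_cancel[OF L2]
  have Cc: "C \<in> carrier_mat m n"
    unfolding C by (intro mult_carrier_mat[of _ m n _ n] mult_carrier_mat[of _ m m _ n])
      (use A12 inv1 inv2 in auto)
  have Ct: "transpose_mat C \<in> carrier_mat n m" using Cc by simp
  have LC: "L2 * transpose_mat C \<in> carrier_mat n m"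
    by (rule mult_carrier_mat[OF c2 Ct])
  note rect = assoc_mult_mat[of _ m m _ n _ n] assoc_mult_mat[of _ m n _ n _ n]
    assoc_mult_mat[of _ m m _ m _ n] mult_carrier_mat[of _ m m _ n] mult_carrier_mat[of _ m n _ n]
  have cancel1: "L1 * (mat_inv L1 * Z) = Z" if "Z \<in> carrier_mat m n" for Z
    using that c1 inv1 by (simp flip: assoc_mult_mat[of _ m m _ m _ n])
  have "L1 * transpose_mat (L2 * transpose_mat C) = L1 * (C * transpose_mat L2)"
    using c2 Ct by (simp add: transpose_mult[of _ n n _ m])
  also have "\<dots> = A12 * (transpose_mat (mat_inv L2) * transpose_mat L2)"
    using c1 c2 A12 inv1(1) inv2(1) by (simp add: C rect cancel1)
  also have "\<dots> = A12"
    using A12 by (simp add: tinv2)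
  finally have A12_eq: "L1 * transpose_mat (L2 * transpose_mat C) = A12" .
  obtain P X Y where P: "lower_pos m P" and X: "X \<in> carrier_mat n m" and Y: "lower_pos n Y"
    and Leq: "L = four_block_mat P (0\<^sub>m m n) X Y"
    by (rule lower_pos_block_decomp[OF L])
  note Pc = lower_pos_carrier[OF P] and Yc = lower_pos_carrier[OF Y]
  have Xt: "transpose_mat X \<in> carrier_mat m n" using X by simp
  have "four_block_mat (P * transpose_mat P) (P * transpose_mat X)
        (X * transpose_mat P) (X * transpose_mat X + Y * transpose_mat Y)
      = four_block_mat (L1 * transpose_mat L1) A12 (transpose_mat A12) (L2 * transpose_mat L2)"
    unfolding lower_block_gram[OF Pc X Yc, symmetric] Leq[symmetric] by (rule eq)
  note blocks = four_block_mat_eqD[OF this, of m n]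
  have PP: "P * transpose_mat P = L1 * transpose_mat L1" and PX: "P * transpose_mat X = A12"
    and XY: "X * transpose_mat X + Y * transpose_mat Y = L2 * transpose_mat L2"
    by (rule blocks; use Pc X Yc c1 c2 A12 in \<open>auto intro!: mult_carrier_mat add_carrier_mat\<close>)+
  have P1: "P = L1" by (rule lower_pos_gram_unique[OF P L1 PP])
  have "mat_inv L1 * (L1 * transpose_mat X)
      = mat_inv L1 * (L1 * transpose_mat (L2 * transpose_mat C))"
    using PX A12_eq P1 by simp
  moreover have "mat_inv L1 * (L1 * Z) = Z" if "Z \<in> carrier_mat m n" for Z
    using that c1 inv1 by (simp flip: assoc_mult_mat[of _ m m _ m _ n])
  ultimately have "transpose_mat X = transpose_mat (L2 * transpose_mat C)"
    using Xt LC by simp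
  then have X2: "X = L2 * transpose_mat C"
    by simp
  define J where "J = mat_inv L2"
  have J: "J \<in> carrier_mat n n" "L2 * J = 1\<^sub>m n" "J * L2 = 1\<^sub>m n"
    "transpose_mat L2 * transpose_mat J = 1\<^sub>m n"
    using inv2 tinv2 by (auto simp: J_def)
  define D where "D = J * Y"
  have Dc: "D \<in> carrier_mat n n" using J Yc by (simp add: D_def)
  have "L2 * D = L2 * J * Y"
    using c2 J(1) Yc by (simp add: D_def square_mat_simps[where n = n])
  then have L2D: "L2 * D = Y"
    using J Yc by simp
  then have D: "lower_pos n D"
    using lower_pos_left_quotient(1)[OF L2 Dc] Y by simp
  define S where "S = transpose_mat C * C + D * transpose_mat D"
  have CC: "transpose_mat C * C \<in> carrier_mat n n"
    by (rule mult_carrier_mat[OF Ct Cc])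
  have S: "S \<in> carrier_mat n n"
    using CC Dc by (simp add: S_def square_mat_simps[where n = n])
  have "L2 * S * transpose_mat L2 = L2 * transpose_mat L2"
    unfolding S_def corner_gram[OF Cc c2 Dc, symmetric] using XY by (simp add: X2 L2D)
  then have "J * (L2 * S * transpose_mat L2) * transpose_mat J
      = J * (L2 * transpose_mat L2) * transpose_mat J"
    by simp
  moreover have "J * (L2 * S * transpose_mat L2) * transpose_mat J
      = (J * L2) * S * (transpose_mat L2 * transpose_mat J)"
    "J * (L2 * transpose_mat L2) * transpose_mat J = (J * L2) * (transpose_mat L2 * transpose_mat J)"
    using S c2 J(1) by (simp_all add: square_mat_simps[where n = n])
  ultimately have "S = 1\<^sub>m n"
    using S J by simp
  then show thesis
    using that[OF D] A12_eq Leq P1 X2 L2D by (simp add: S_def)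
qed

section \<open>Eigenvalues of a Gram matrix and norms of its triangular factor\<close>

lemma lower_pos_quadratic_pos:
  assumes D: "lower_pos n D" and x: "x \<in> carrier_vec n" "vec_norm2 x \<noteq> 0"
  shows "0 < x \<bullet> (D * transpose_mat D *\<^sub>v x)"
proof -
  note Dc = lower_pos_carrier[OF D] and Jc = lower_pos_mat_inv(1)[OF D]
  have "x = transpose_mat (mat_inv D) *\<^sub>v (transpose_mat D *\<^sub>v x)"
    using x Dc Jc transpose_mat_inv_cancel(2)[OF D]
    by (simp flip: assoc_mult_mat_vec[of _ n n _ n])
  then have "transpose_mat D *\<^sub>v x \<noteq> 0\<^sub>v n"
    using x(2) Jc by (auto intro!: eq_vecI simp: vec_norm2_eq_0_iff[OF x(1)])
  then have "vec_norm2 (transpose_mat D *\<^sub>v x) \<noteq> 0"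
    using vec_norm2_eq_0_iff[of "transpose_mat D *\<^sub>v x" n] Dc x by simp
  then show ?thesis
    unfolding vec_norm2_transpose_mult_square[OF Dc x(1), symmetric] by simp
qed

context
  fixes n :: nat and V D :: "real mat" and d :: "nat \<Rightarrow> real"
  assumes orth: "orthonormal_mat V" and V: "V \<in> carrier_mat n n"
    and D: "lower_pos n D" and gram: "D * transpose_mat D = conj_diag n V d"
begin

text \<open>The quadratic form of \<open>D D^T\<close> at the unit eigenvector
  \<open>col V i\<close> has the value \<open>d i\<close>. For the eigenvalues of
  \<open>I - C^T C\<close> this yields that the singular values are below 1.\<close>

lemma gram_eigenvalue_pos:
  assumes i: "i < n"
  shows "0 < d i"
proof -
  let ?v = "col V i"
  have v: "?v \<in> carrier_vec n" using V i by simp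
  have "?v \<bullet> ?v = (transpose_mat V * V) $$ (i, i)"
    using V i by simp
  then have vv: "?v \<bullet> ?v = 1"
    using orthonormal_matD[OF orth V] i by simp
  then have "vec_norm2 ?v \<noteq> 0"
    by (simp add: vec_norm2_def)
  then have "0 < ?v \<bullet> (conj_diag n V d *\<^sub>v ?v)"
    using lower_pos_quadratic_pos[OF D v] gram by simp
  then show ?thesis
    using v vv by (simp add: conj_diag_mult_col[OF orth V i])
qed

lemma norm_bound_gram_root:
  assumes "0 \<le> b" "\<And>i. i < n \<Longrightarrow> d i \<le> b"
  shows "norm_bound D (sqrt b)"
proof -
  note Dc = lower_pos_carrier[OF D]
  have "norm_bound (transpose_mat D) (sqrt b)"
  proof (rule norm_boundI)
    fix x :: "real vec" assume x: "x \<in> carrier_vec n"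
    have "(vec_norm2 (transpose_mat D *\<^sub>v x))\<^sup>2 \<le> (sqrt b * vec_norm2 x)\<^sup>2"
      using conj_diag_quadratic_le[OF orth V x, of d b] assms
      by (simp add: vec_norm2_transpose_mult_square[OF Dc x] gram power_mult_distrib)
    then show "vec_norm2 (transpose_mat D *\<^sub>v x) \<le> sqrt b * vec_norm2 x"
      by (rule power2_le_imp_le) (simp add: assms)
  qed (use Dc assms in auto)
  then show ?thesis
    using norm_bound_transpose[of "transpose_mat D" n n "sqrt b"] Dc by simp
qed

text \<open>For \<open>x = D^-T y\<close> the quadratic form of \<open>D D^T\<close> at
  \<open>x\<close> is the squared norm of \<open>y\<close>, and it is at least \<open>a\<close>
  times the squared norm of \<open>x\<close>.\<close>

lemma norm_bound_gram_root_inv: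
  assumes "0 < a" "\<And>i. i < n \<Longrightarrow> a \<le> d i"
  shows "norm_bound (mat_inv D) (1 / sqrt a)"
proof -
  note Dc = lower_pos_carrier[OF D] and Jc = lower_pos_mat_inv(1)[OF D]
  have "norm_bound (transpose_mat (mat_inv D)) (1 / sqrt a)"
  proof (rule norm_boundI)
    fix y :: "real vec" assume y: "y \<in> carrier_vec n"
    let ?x = "transpose_mat (mat_inv D) *\<^sub>v y"
    have x: "?x \<in> carrier_vec n" using Jc y by simp
    have "transpose_mat D *\<^sub>v ?x = y"
      using y Dc Jc transpose_mat_inv_cancel(1)[OF D] by (simp flip: assoc_mult_mat_vec[of _ n n _ n])
    then have "(sqrt a * vec_norm2 ?x)\<^sup>2 \<le> (vec_norm2 y)\<^sup>2"
      using conj_diag_quadratic_ge[OF orth V x, of a d] assms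
        vec_norm2_transpose_mult_square[OF Dc x]
      by (simp add: gram power_mult_distrib)
    then have "sqrt a * vec_norm2 ?x \<le> vec_norm2 y"
      by (rule power2_le_imp_le) simp
    then show "vec_norm2 ?x \<le> 1 / sqrt a * vec_norm2 y"
      using assms(1) by (simp add: field_simps)
  qed (use Jc assms in auto)
  then show ?thesis
    using norm_bound_transpose[of "transpose_mat (mat_inv D)" n n "1 / sqrt a"] Jc by simp
qed

end

section \<open>Semidefinite matrices, block arithmetic and scalar estimates\<close>

lemma sym_pos_semidef_conj_diag:
  assumes "orthonormal_mat V" "V \<in> carrier_mat n n" "\<And>i. i < n \<Longrightarrow> 0 \<le> d i"
  shows "sym_pos_semidef (conj_diag n V d)"
  using assms conj_diag_carrier[OF assms(1,2), of d] conj_diag_quadratic_ge[OF assms(1,2), of _ 0 d]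
  by (auto simp: sym_pos_semidef_def transpose_conj_diag)

lemma sym_pos_semidef_congruence:
  assumes F: "sym_pos_semidef F" "F \<in> carrier_mat n n" and L: "L \<in> carrier_mat n n"
  shows "sym_pos_semidef (L * F * transpose_mat L)"
proof -
  have c: "L * F * transpose_mat L \<in> carrier_mat n n"
    using F L by (simp add: square_mat_simps[where n = n])
  have "transpose_mat (L * F * transpose_mat L) = L * F * transpose_mat L"
    using F L by (simp add: square_mat_simps[where n = n] sym_pos_semidef_def)
  moreover have "0 \<le> x \<bullet> (L * F * transpose_mat L *\<^sub>v x)" if x: "x \<in> carrier_vec n" for x
  proof -
    let ?y = "transpose_mat L *\<^sub>v x"
    have y: "?y \<in> carrier_vec n" using L x by simp
    have "x \<bullet> (L * F * transpose_mat L *\<^sub>v x) = x \<bullet> (L *\<^sub>v (F *\<^sub>v ?y))"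
      using F L x by (simp add: square_mat_simps[where n = n])
    also have "\<dots> = ?y \<bullet> (F *\<^sub>v ?y)"
      using F L x y by (intro transpose_vec_mult_scalar[OF L, symmetric]) auto
    finally show ?thesis using F y by (auto simp: sym_pos_semidef_def)
  qed
  ultimately show ?thesis
    using c carrier_matD[OF c] unfolding sym_pos_semidef_def by (simp only: square_mat.simps) auto
qed

lemma sym_pos_semidef_corner:
  assumes X: "sym_pos_semidef X" "X \<in> carrier_mat n n"
  shows "sym_pos_semidef (four_block_mat (0\<^sub>m m m) (0\<^sub>m m n) (0\<^sub>m n m) X)" (is "sym_pos_semidef ?E")
  unfolding sym_pos_semidef_def
proof (intro conjI ballI)
  show "square_mat ?E" using X by simp
  show "transpose_mat ?E = ?E"
    using X by (subst transpose_four_block_mat[of _ m m _ n _ n]) (auto simp: sym_pos_semidef_def)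
  fix x :: "real vec" assume "x \<in> carrier_vec (dim_row ?E)"
  then have x: "x \<in> carrier_vec (m + n)" using X by simp
  define x1 where "x1 = vec_first x m"
  define x2 where "x2 = vec_last x n"
  have xs: "x1 \<in> carrier_vec m" "x2 \<in> carrier_vec n" and xeq: "x = x1 @\<^sub>v x2"
    using x by (simp_all add: x1_def x2_def)
  have "?E *\<^sub>v x = 0\<^sub>v m @\<^sub>v (X *\<^sub>v x2)"
    unfolding xeq using X xs by (subst mult_mat_vec_split[of _ m _ n]) auto
  then have "x \<bullet> (?E *\<^sub>v x) = x2 \<bullet> (X *\<^sub>v x2)"
    using X xs unfolding xeq by (simp add: scalar_prod_append[of _ m _ n])
  then show "0 \<le> x \<bullet> (?E *\<^sub>v x)"
    using X xs by (auto simp: sym_pos_semidef_def)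
qed

lemma lower_block_mult_diag:
  fixes P X Q W :: "real mat"
  assumes "P \<in> carrier_mat m m" "X \<in> carrier_mat n m" "Q \<in> carrier_mat n n" "W \<in> carrier_mat n n"
  shows "four_block_mat P (0\<^sub>m m n) X Q * four_block_mat (1\<^sub>m m) (0\<^sub>m m n) (0\<^sub>m n m) W
    = four_block_mat P (0\<^sub>m m n) X (Q * W)"
  using assms
  by (subst mult_four_block_mat[of _ m m _ n _ n _ _ m _ n]) (auto simp: mult_carrier_mat[of _ n n _ n])

lemma lower_block_minus:
  fixes P X Y Z :: "real mat"
  assumes "P \<in> carrier_mat m m" "X \<in> carrier_mat n m" "Y \<in> carrier_mat n n" "Z \<in> carrier_mat n n"
  shows "four_block_mat P (0\<^sub>m m n) X Y - four_block_mat P (0\<^sub>m m n) X Z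
    = four_block_mat (0\<^sub>m m m) (0\<^sub>m m n) (0\<^sub>m n m) (Y - Z)"
  using assms by (intro eq_matI) auto

lemma minus_mat_eqI:
  fixes X Y Z :: "real mat"
  assumes "X \<in> carrier_mat p q" "Y \<in> carrier_mat p q" "X + Y = Z"
  shows "Y = Z - X"
  using assms by (intro eq_matI) auto

text \<open>The number of bisection levels that suffices for \<open>n\<close> indices.\<close>

lemma le_two_power_ceiling_log:
  assumes "1 \<le> n"
  shows "n \<le> 2 ^ nat \<lceil>log 2 (real n)\<rceil>"
proof -
  define k where "k = nat \<lceil>log 2 (real n)\<rceil>"
  have "log 2 (real n) \<le> real k"
    unfolding k_def by linarith
  then have "2 powr log 2 (real n) \<le> 2 powr real k"
    by (intro powr_mono) auto
  then have "real n \<le> real (2 ^ k)"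
    using assms by (simp add: powr_realpow)
  then show ?thesis
    unfolding k_def by (simp only: of_nat_le_iff)
qed

text \<open>The case \<open>y = 0\<close> is harmless since the quotient is then 0; so the lemma
  applies to a norm in the denominator that is only known to be nonnegative.\<close>

lemma divide_le_of_le_mult:
  fixes x y q :: real
  assumes "x \<le> y * q" "0 \<le> y" "0 \<le> q"
  shows "x / y \<le> q"
  using assms by (cases "y = 0") (auto simp: divide_simps mult_ac)

text \<open>For \<open>0 < t\<close> the root is below 1, so its square \<open>1 - t\<close> is
  smaller than the root itself. For \<open>t = 0\<close> strictness comes from
  \<open>0 < b\<close>.\<close>

lemma one_minus_sqrt_less:
  fixes t b :: real
  assumes "0 \<le> t" "t < 1" "t \<le> b" "0 < b"
  shows "1 - sqrt (1 - t) < b"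
proof (cases "t = 0")
  case False
  have "1 - t = sqrt (1 - t) * sqrt (1 - t)" using assms by simp
  also have "\<dots> < sqrt (1 - t) * 1"
    using assms False by (intro mult_strict_left_mono) auto
  finally show ?thesis using assms by simp
qed (use assms in simp)

section \<open>Low-rank approximation of the Schur complement\<close>

theorem theorem2p1:
  fixes m n r :: nat
    and A A11 A12 A21 A22 L1 L2 C U Sg V S1 V1 D2t L Lt At Ls Lts :: "real mat"
    and \<sigma> :: "nat \<Rightarrow> real"
    and \<tau> \<sigma>n c :: real
  assumes A11: "A11 \<in> carrier_mat m m"
    and A12: "A12 \<in> carrier_mat m n"
    and A21: "A21 = transpose_mat A12"
    and A22: "A22 \<in> carrier_mat n n"
    and A: "A = four_block_mat A11 A12 A21 A22"
    and A_pd: "sym_pos_def A"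
    and L1: "cholesky_factor A11 L1"
    and L2: "cholesky_factor A22 L2"
    and C: "C = mat_inv L1 * A12 * transpose_mat (mat_inv L2)"
    and svd: "full_svd C U Sg V"
    and \<sigma>: "\<sigma> = (\<lambda>i. Sg $$ (i - 1, i - 1))"
    and r: "1 \<le> r" "r < min m n"
    and S1: "S1 = mat_diag r (\<lambda>i. \<sigma> (i + 1))"
    and V1: "V1 = mat n r (\<lambda>(i, j). V $$ (i, j))"
    and \<tau>: "\<tau> > 0" "\<sigma> r \<ge> \<tau>" "\<tau> \<ge> \<sigma> (r + 1)"
    and D2t: "cholesky_factor (1\<^sub>m n - V1 * (S1 * S1) * transpose_mat V1) D2t"
    and Lt: "Lt = four_block_mat L1 (0\<^sub>m m n) (L2 * transpose_mat C) L2
                  * four_block_mat (1\<^sub>m m) (0\<^sub>m m n) (0\<^sub>m n m) D2t"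
    and At: "At = Lt * transpose_mat Lt"
    and L: "cholesky_factor A L"
    and \<sigma>n: "\<sigma>n = (if m \<ge> n then \<sigma> n else 0)"
    and c: "c = 1 + 2 * real_of_int \<lceil>log 2 (real n)\<rceil>"
    and Lts: "Lts = four_block_mat L1 (0\<^sub>m m n) (L2 * transpose_mat C) L2
                  * four_block_mat (1\<^sub>m m) (0\<^sub>m m n) (0\<^sub>m n m)
                      (psd_sqrt (1\<^sub>m n - V1 * (S1 * S1) * transpose_mat V1))"
    and Ls: "Ls = four_block_mat L1 (0\<^sub>m m n) (L2 * transpose_mat C)
                    (L2 * psd_sqrt (1\<^sub>m n - V * transpose_mat Sg * Sg * transpose_mat V))"
  shows "(\<forall>i \<in> {1..min m n}. \<sigma> i < 1) \<and>
    (\<exists>E \<in> carrier_mat (m + n) (m + n).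
       At = A + E \<and> sym_pos_semidef E \<and>
       spectral_norm E / spectral_norm A \<le> (\<sigma> (r + 1))\<^sup>2 \<and> (\<sigma> (r + 1))\<^sup>2 \<le> \<tau>\<^sup>2) \<and>
    spectral_norm (Lt - L) / spectral_norm L \<le> c * sqrt (1 - \<sigma>n\<^sup>2) / (1 - (\<sigma> 1)\<^sup>2) * \<tau>\<^sup>2 \<and>
    A = Ls * transpose_mat Ls \<and>
    spectral_norm (Lts - Ls) / spectral_norm Ls < \<tau>\<^sup>2"
proof -
  \<comment> \<open>\<open>s\<close> counts from 0 and is padded with zeros up to \<open>n\<close>,
    the size of \<open>C^T C\<close>; \<open>\<sigma>\<close> counts from 1, so
    \<open>\<sigma> (i + 1) = s i\<close> for \<open>i < m\<close>.\<close>
  define s where "s i = (if i < m then Sg $$ (i, i) else 0)" for i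
  define t where "t = (\<sigma> (r + 1))\<^sup>2"
  \<comment> \<open>The spectrum of the part of \<open>C^T C\<close> that the truncation discards;
    its values are at most \<open>t\<close>.\<close>
  define e where "e i = (if i < r then 0 else (s i)\<^sup>2)" for i
  have n0: "0 < n" and m0: "0 < m" and rn: "r < n" and rm: "r < m"
    using r by auto
  have A_carrier: "A \<in> carrier_mat (m + n) (m + n)"
    unfolding A using A11 A22 by simp
  have A21c: "A21 \<in> carrier_mat n m" using A12 A21 by simp
  have L1l: "lower_pos m L1" and A11_eq: "A11 = L1 * transpose_mat L1"
    using L1 A11 by (auto simp: cholesky_factor_iff simp del: index_mult_mat)
  have L2l: "lower_pos n L2" and A22_eq: "A22 = L2 * transpose_mat L2"
    using L2 A22 by (auto simp: cholesky_factor_iff simp del: index_mult_mat)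
  have Ll: "lower_pos (m + n) L" and A_eq: "A = L * transpose_mat L"
    using L A_carrier by (auto simp: cholesky_factor_iff simp del: index_mult_mat)
  note c1 = lower_pos_carrier[OF L1l] and c2 = lower_pos_carrier[OF L2l] and cL = lower_pos_carrier[OF Ll]
  have gram_L: "L * transpose_mat L
      = four_block_mat (L1 * transpose_mat L1) A12 (transpose_mat A12) (L2 * transpose_mat L2)"
    unfolding A_eq[symmetric] A A21 A11_eq[symmetric] A22_eq[symmetric] ..
  obtain D where D: "lower_pos n D" and CD: "transpose_mat C * C + D * transpose_mat D = 1\<^sub>m n"
    and L_eq: "L = four_block_mat L1 (0\<^sub>m m n) (L2 * transpose_mat C) (L2 * D)"
    and A12_eq: "L1 * transpose_mat (L2 * transpose_mat C) = A12"
    by (rule block_cholesky[OF L1l L2l A12 C Ll gram_L])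
  note cD = lower_pos_carrier[OF D]
  have cC: "C \<in> carrier_mat m n"
    using A12 lower_pos_mat_inv(1)[OF L1l] lower_pos_mat_inv(1)[OF L2l] unfolding C
    by (intro mult_carrier_mat[of _ m n _ n] mult_carrier_mat[of _ m m _ n]) auto
  have cCt: "transpose_mat C \<in> carrier_mat n m" using cC by simp
  have cL2C: "L2 * transpose_mat C \<in> carrier_mat n m"
    by (rule mult_carrier_mat[OF c2 cCt])
  have cCC: "transpose_mat C * C \<in> carrier_mat n n"
    by (rule mult_carrier_mat[OF cCt cC])
  have V: "V \<in> carrier_mat n n" and orth: "orthonormal_mat V"
    using svd cC by (auto simp: full_svd_def)
  note conj_c = conj_diag_carrier[OF orth V]
  have s_nonneg: "0 \<le> s i" if "i < n" for i
    using svd cC that by (auto simp: full_svd_def s_def)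
  have s_antimono: "s j \<le> s i" if "i \<le> j" "j < n" for i j
    using svd cC that s_nonneg[of i] by (auto simp: full_svd_def s_def)
  have sigma_s: "\<sigma> (i + 1) = s i" if "i < m" for i
    using that by (simp add: \<sigma> s_def)
  have CC: "transpose_mat C * C = conj_diag n V (\<lambda>i. (s i)\<^sup>2)"
    and VSV: "V * transpose_mat Sg * Sg * transpose_mat V = conj_diag n V (\<lambda>i. (s i)\<^sup>2)"
    using full_svd_gram[OF svd cC] by (simp_all add: s_def)
  have one_minus: "1\<^sub>m n - conj_diag n V d = conj_diag n V (\<lambda>i. 1 - d i)" for d
    unfolding conj_diag_one[OF orth V, symmetric] conj_diag_minus[OF orth V] ..
  have "D * transpose_mat D = 1\<^sub>m n - transpose_mat C * C"
    using cCC cD CD by (intro minus_mat_eqI[of _ n n]) (auto simp: square_mat_simps[where n = n])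
  then have DD: "D * transpose_mat D = conj_diag n V (\<lambda>i. 1 - (s i)\<^sup>2)"
    by (simp only: CC one_minus)
  \<comment> \<open>The existence of the triangular factor \<open>D\<close> makes
    \<open>I - C^T C\<close> positive definite.\<close>
  have s_sq: "(s i)\<^sup>2 < 1" if "i < n" for i
    using gram_eigenvalue_pos[OF orth V D DD that] by simp
  have s_lt: "s i < 1" if "i < n" for i
    using s_sq[OF that] s_nonneg[OF that] by (simp add: power2_less_1_iff)
  have s_sq_mono: "(s j)\<^sup>2 \<le> (s i)\<^sup>2" if "i \<le> j" "j < n" for i j
    using s_antimono[OF that] s_nonneg[OF that(2)] by (rule power_mono)
  have t_s: "t = (s r)\<^sup>2" using sigma_s[OF rm] by (simp add: t_def)
  have t_nonneg: "0 \<le> t" by (simp add: t_def)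
  have t_less: "t < 1" using s_sq[OF rn] by (simp add: t_s)
  have t_le: "t \<le> \<tau>\<^sup>2"
    unfolding t_s using \<tau>(3) sigma_s[OF rm] s_nonneg[OF rn] by (intro power_mono) auto
  have e_bounds: "0 \<le> e i" "e i \<le> t" if "i < n" for i
    using that s_sq_mono[of r i] t_nonneg by (auto simp: e_def t_s)
  have V1_conj: "V1 * (S1 * S1) * transpose_mat V1 = conj_diag n V (\<lambda>i. if i < r then (s i)\<^sup>2 else 0)"
  proof -
    have "S1 * S1 = mat_diag r (\<lambda>i. (\<sigma> (i + 1))\<^sup>2)"
      by (simp add: S1 power2_eq_square)
    then have "V1 * (S1 * S1) * transpose_mat V1
        = conj_diag n V (\<lambda>i. if i < r then (\<sigma> (i + 1))\<^sup>2 else 0)"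
      using conj_diag_truncate[OF V less_imp_le[OF rn], of "\<lambda>i. (\<sigma> (i + 1))\<^sup>2"] by (simp add: V1)
    also have "\<dots> = conj_diag n V (\<lambda>i. if i < r then (s i)\<^sup>2 else 0)"
      using rm sigma_s by (intro conj_diag_cong[OF orth V]) simp
    finally show ?thesis .
  qed
  \<comment> \<open>Only the first \<open>r\<close> squares are subtracted, so from index
    \<open>r\<close> on the eigenvalue is 1.\<close>
  have trunc: "1\<^sub>m n - V1 * (S1 * S1) * transpose_mat V1
      = conj_diag n V (\<lambda>i. 1 - (s i)\<^sup>2 + e i)"
    unfolding V1_conj one_minus by (intro conj_diag_cong[OF orth V]) (simp add: e_def)
  have D2l: "lower_pos n D2t"
    and DD2: "D2t * transpose_mat D2t = conj_diag n V (\<lambda>i. 1 - (s i)\<^sup>2 + e i)"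
    using D2t conj_c[of "\<lambda>i. 1 - (s i)\<^sup>2 + e i"] unfolding trunc
    by (auto simp: cholesky_factor_iff simp del: index_mult_mat)
  note cD2 = lower_pos_carrier[OF D2l]

  \<comment> \<open>\<open>Lt\<close> and \<open>L\<close> share their first block column, so
    \<open>At - A\<close> is confined to the lower right corner, where it equals
    \<open>F\<close>.\<close>
  define F where "F = L2 * conj_diag n V e * transpose_mat L2"
  define E where "E = four_block_mat (0\<^sub>m m m) (0\<^sub>m m n) (0\<^sub>m n m) F"
  have cF: "F \<in> carrier_mat n n"
    using c2 conj_c[of e] by (simp add: F_def square_mat_simps[where n = n])
  have cE: "E \<in> carrier_mat (m + n) (m + n)"
    using cF by (simp add: E_def)
  have block_gram: "four_block_mat L1 (0\<^sub>m m n) (L2 * transpose_mat C) (L2 * W)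
        * transpose_mat (four_block_mat L1 (0\<^sub>m m n) (L2 * transpose_mat C) (L2 * W))
      = four_block_mat A11 A12 A21 (L2 * conj_diag n V (\<lambda>i. (s i)\<^sup>2 + w i) * transpose_mat L2)"
    if W: "W \<in> carrier_mat n n" "W * transpose_mat W = conj_diag n V w" for W w
  proof -
    have LW: "L2 * W \<in> carrier_mat n n" using c2 W by simp
    have "L2 * transpose_mat C * transpose_mat L1 = A21"
      unfolding A21 A12_eq[symmetric] using c1 cL2C by (simp add: transpose_mult[of _ m m _ n])
    then show ?thesis
      unfolding lower_block_gram[OF c1 cL2C LW] corner_gram[OF cC c2 W(1)] W(2) CC
        conj_diag_add[OF orth V] A12_eq A11_eq[symmetric] by simp
  qed
  have Lt_eq: "Lt = four_block_mat L1 (0\<^sub>m m n) (L2 * transpose_mat C) (L2 * D2t)"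
    unfolding Lt by (rule lower_block_mult_diag[OF c1 cL2C c2 cD2])
  have "L2 * conj_diag n V (\<lambda>i. (s i)\<^sup>2 + (1 - (s i)\<^sup>2 + e i)) * transpose_mat L2
      = L2 * (1\<^sub>m n + conj_diag n V e) * transpose_mat L2"
    unfolding conj_diag_one[OF orth V, symmetric] conj_diag_add[OF orth V] by simp
  also have "\<dots> = A22 + F"
    using c2 conj_c[of e]
    by (simp add: F_def A22_eq square_mat_simps[where n = n] mult_add_distrib_mat[of _ n n _ n]
        add_mult_distrib_mat[of _ n n _ _ n])
  finally have "At = four_block_mat A11 A12 A21 (A22 + F)"
    unfolding At Lt_eq block_gram[OF cD2 DD2] by simp
  also have "\<dots> = A + E"
    unfolding A E_def using A11 A12 A21c A22 cF
    by (subst add_four_block_mat[of _ m m _ n _ n]) auto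
  finally have At_eq: "At = A + E" .
  have E_psd: "sym_pos_semidef E"
    unfolding E_def F_def
    using e_bounds c2 conj_c[of e] cF[unfolded F_def]
    by (intro sym_pos_semidef_corner sym_pos_semidef_congruence sym_pos_semidef_conj_diag[OF orth V])
      auto
  have e_norm: "norm_bound (conj_diag n V e) t"
    using e_bounds t_nonneg by (intro norm_bound_conj_diag[OF orth V]) auto
  have nonneg: "0 \<le> spectral_norm M" if "M \<in> carrier_mat (m + n) (m + n)" for M
    using that n0 by (intro spectral_norm_nonneg) auto
  have bound: "norm_bound M (spectral_norm M)" if "M \<in> carrier_mat (m + n) (m + n)" for M
    using that n0 by (intro norm_bound_spectral_norm) auto
  \<comment> \<open>Each of the two factors \<open>L2\<close> in \<open>F\<close> contributes the
    square root of the norm of \<open>A\<close>, so this norm cancels in the relative bound.\<close>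
  have "norm_bound L2 (sqrt (spectral_norm A))"
    using bound[OF A_carrier] unfolding A A22_eq
    by (intro norm_bound_block_sqrt[OF A11 A12 A21c c2])
  then have "norm_bound F (sqrt (spectral_norm A) * t * sqrt (spectral_norm A))"
    unfolding F_def using c2 conj_c[of e] e_norm
    by (intro norm_bound_mult[of _ n n _ n] norm_bound_transpose[of _ n n]) auto
  then have "norm_bound E (spectral_norm A * t)"
    unfolding E_def using nonneg[OF A_carrier]
    by (intro norm_bound_four_block_corner[OF cF]) (simp add: mult.commute mult.left_commute)
  then have "spectral_norm E \<le> spectral_norm A * t"
    using cE n0 by (intro spectral_norm_le) auto
  then have E_norm: "spectral_norm E / spectral_norm A \<le> t"
    using nonneg[OF A_carrier] t_nonneg by (rule divide_le_of_le_mult)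

  \<comment> \<open>Two block factors with a common first block column differ by
    \<open>L2 * (W - W')\<close> in the corner. Since the norm of \<open>L2\<close> is at most that
    of any \<open>M\<close> with \<open>M M^T = A\<close>, the relative error is controlled by
    \<open>W - W'\<close> alone.\<close>
  have diff_norm: "spectral_norm (four_block_mat L1 (0\<^sub>m m n) (L2 * transpose_mat C) (L2 * W)
        - four_block_mat L1 (0\<^sub>m m n) (L2 * transpose_mat C) (L2 * W')) / spectral_norm M \<le> q"
    if W: "W \<in> carrier_mat n n" "W' \<in> carrier_mat n n" and q: "norm_bound (W - W') q"
      and M: "M \<in> carrier_mat (m + n) (m + n)" "M * transpose_mat M = A" for W W' M q
  proof (rule divide_le_of_le_mult)
    have "norm_bound L2 (spectral_norm M)"
      using norm_bound_gram_block[OF A11 A12 A21c c2 M(1) _ bound[OF M(1)]] M(2)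
      unfolding A A22_eq by simp
    then have "norm_bound (L2 * (W - W')) (spectral_norm M * q)"
      using c2 W q by (intro norm_bound_mult[of _ n n _ n]) auto
    also have "L2 * (W - W') = L2 * W - L2 * W'"
      using c2 W by (simp add: mult_minus_distrib_mat[of _ n n _ n])
    finally have "norm_bound (four_block_mat (0\<^sub>m m m) (0\<^sub>m m n) (0\<^sub>m n m) (L2 * W - L2 * W'))
        (spectral_norm M * q)"
      using c2 W by (intro norm_bound_four_block_corner) auto
    then show "spectral_norm (four_block_mat L1 (0\<^sub>m m n) (L2 * transpose_mat C) (L2 * W)
        - four_block_mat L1 (0\<^sub>m m n) (L2 * transpose_mat C) (L2 * W')) \<le> spectral_norm M * q"
      using c1 cL2C c2 W n0 by (subst lower_block_minus) (auto intro!: spectral_norm_le)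
  qed (use nonneg M norm_bound_nonneg[OF q] in auto)

  define k where "k = nat \<lceil>log 2 (real n)\<rceil>"
  define a where "a = 1 - (\<sigma> 1)\<^sup>2"
  define h where "h = sqrt (1 - \<sigma>n\<^sup>2)"
  have sigma1: "\<sigma> 1 = s 0" using sigma_s[of 0] m0 by simp
  have a_eq: "a = 1 - (s 0)\<^sup>2" unfolding a_def sigma1 ..
  have a_pos: "0 < a" using s_sq[OF n0] by (simp add: a_eq)
  \<comment> \<open>If \<open>m < n\<close>, both sides are 0, because the index
    \<open>n - 1\<close> lies in the padded range of \<open>s\<close>.\<close>
  have sigman: "\<sigma>n = s (n - 1)"
    using n0 sigma_s[of "n - 1"] by (auto simp: \<sigma>n s_def)
  \<comment> \<open>The eigenvalues \<open>1 - (s i)\<^sup>2\<close> of \<open>D D^T\<close>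
    increase with \<open>i\<close>: the last one bounds \<open>D\<close>, and the first one,
    \<open>a\<close>, bounds its inverse.\<close>
  have h_bound: "norm_bound D h"
    unfolding h_def sigman
    using s_sq[of "n - 1"] s_sq_mono[of _ "n - 1"] n0
    by (intro norm_bound_gram_root[OF orth V D DD]) (auto simp: less_imp_le)
  have g_bound: "norm_bound (mat_inv D) (1 / sqrt a)"
    using a_pos s_sq_mono[of 0]
    by (intro norm_bound_gram_root_inv[OF orth V D DD]) (auto simp: a_eq)
  have D_diff: "norm_bound (D2t - D) (h * ((1 + real k) * (1 / sqrt a * t * (1 / sqrt a))))"
  proof (rule norm_bound_cholesky_diff[OF D D2l conj_c[of e] _ _ e_norm g_bound h_bound])
    show "D2t * transpose_mat D2t = D * transpose_mat D + conj_diag n V e"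
      unfolding DD2 DD conj_diag_add[OF orth V] ..
    show "0 \<le> x \<bullet> (conj_diag n V e *\<^sub>v x)" if "x \<in> carrier_vec n" for x
      using conj_diag_quadratic_ge[OF orth V that, of 0 e] e_bounds by simp
    show "n \<le> 2 ^ k"
      unfolding k_def using n0 by (intro le_two_power_ceiling_log) simp
  qed
  have "spectral_norm (Lt - L) / spectral_norm L \<le> h * ((1 + real k) * (1 / sqrt a * t * (1 / sqrt a)))"
    unfolding Lt_eq using diff_norm[OF cD2 cD D_diff cL A_eq[symmetric]] unfolding L_eq[symmetric] .
  also have "\<dots> = h / a * ((1 + real k) * t)"
    using a_pos by (simp add: field_simps)
  \<comment> \<open>The bisection yields the constant \<open>1 + real k\<close>, which is at most
    \<open>c = 1 + 2 * real k\<close>; the factor \<open>t\<close> is at most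
    \<open>\<tau>\<^sup>2\<close>.\<close>
  also have "\<dots> \<le> h / a * (c * \<tau>\<^sup>2)"
  proof (intro mult_left_mono mult_mono)
    have "0 \<le> log 2 (real n)" using n0 by simp
    then have "real k = real_of_int \<lceil>log 2 (real n)\<rceil>" "0 \<le> real_of_int \<lceil>log 2 (real n)\<rceil>"
      unfolding k_def by linarith+
    then show "1 + real k \<le> c" "0 \<le> c" unfolding c by auto
    show "0 \<le> h / a" using norm_bound_nonneg[OF h_bound] a_pos by simp
  qed (use t_le t_nonneg in auto)
  also have "\<dots> = c * h / a * \<tau>\<^sup>2"
    by simp
  finally have Lt_norm: "spectral_norm (Lt - L) / spectral_norm L
      \<le> c * sqrt (1 - \<sigma>n\<^sup>2) / (1 - (\<sigma> 1)\<^sup>2) * \<tau>\<^sup>2"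
    by (simp only: h_def a_def)

  define w where "w i = sqrt (1 - (s i)\<^sup>2)" for i
  define wt where "wt i = sqrt (1 - (s i)\<^sup>2 + e i)" for i
  have w_pos: "0 < w i" "0 < wt i" if "i < n" for i
    using s_sq[OF that] e_bounds(1)[OF that] by (auto simp: w_def wt_def)
  have w_sq: "(w i)\<^sup>2 = 1 - (s i)\<^sup>2" "(wt i)\<^sup>2 = 1 - (s i)\<^sup>2 + e i" if "i < n" for i
    using s_sq[OF that] e_bounds(1)[OF that] by (auto simp: w_def wt_def)
  have root: "psd_sqrt (1\<^sub>m n - V * transpose_mat Sg * Sg * transpose_mat V) = conj_diag n V w"
    unfolding VSV one_minus
    using psd_sqrt_conj_diag[OF orth V w_pos(1)] conj_diag_cong[OF orth V w_sq(1)] by simp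
  have root_t: "psd_sqrt (1\<^sub>m n - V1 * (S1 * S1) * transpose_mat V1) = conj_diag n V wt"
    unfolding trunc
    using psd_sqrt_conj_diag[OF orth V w_pos(2)] conj_diag_cong[OF orth V w_sq(2)] by simp
  have Ls_eq: "Ls = four_block_mat L1 (0\<^sub>m m n) (L2 * transpose_mat C) (L2 * conj_diag n V w)"
    unfolding Ls root ..
  have Lts_eq: "Lts = four_block_mat L1 (0\<^sub>m m n) (L2 * transpose_mat C) (L2 * conj_diag n V wt)"
    unfolding Lts root_t by (rule lower_block_mult_diag[OF c1 cL2C c2 conj_c])
  have cLs: "Ls \<in> carrier_mat (m + n) (m + n)"
    unfolding Ls_eq using c1 c2 conj_c[of w] by (intro four_block_carrier_mat) auto
  have ww: "conj_diag n V w * transpose_mat (conj_diag n V w) = conj_diag n V (\<lambda>i. 1 - (s i)\<^sup>2)"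
    unfolding transpose_conj_diag[OF orth V] conj_diag_mult[OF orth V]
    by (intro conj_diag_cong[OF orth V]) (simp add: w_sq flip: power2_eq_square)
  have A_Ls: "A = Ls * transpose_mat Ls"
    unfolding Ls_eq block_gram[OF conj_c ww] A
    using c2 by (simp add: conj_diag_one[OF orth V] A22_eq)
  \<comment> \<open>Both roots are diagonal in the basis \<open>V\<close>. Entries before index
    \<open>r\<close> cancel; from \<open>r\<close> on, the root of the truncated matrix is 1 and the
    other is at least \<open>sqrt (1 - t)\<close> by monotonicity of the singular values.\<close>
  have "norm_bound (conj_diag n V wt - conj_diag n V w) (1 - sqrt (1 - t))"
    unfolding conj_diag_minus[OF orth V]
  proof (rule norm_bound_conj_diag[OF orth V])
    show "0 \<le> 1 - sqrt (1 - t)" using t_nonneg by simp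
    fix i assume i: "i < n"
    show "\<bar>wt i - w i\<bar> \<le> 1 - sqrt (1 - t)"
    proof (cases "i < r")
      case True
      then show ?thesis using t_nonneg by (simp add: wt_def w_def e_def)
    next
      case False
      then have "sqrt (1 - t) \<le> w i" "wt i = 1" "w i \<le> 1"
        using s_sq_mono[of r i] i by (auto simp: wt_def w_def e_def t_s)
      then show ?thesis by simp
    qed
  qed
  from diff_norm[OF conj_c conj_c this cLs A_Ls[symmetric]]
  have "spectral_norm (Lts - Ls) / spectral_norm Ls \<le> 1 - sqrt (1 - t)"
    unfolding Lts_eq Ls_eq[symmetric] .
  also have "\<dots> < \<tau>\<^sup>2"
    using t_nonneg t_less t_le \<tau>(1) by (intro one_minus_sqrt_less) auto
  finally have Ls_norm: "spectral_norm (Lts - Ls) / spectral_norm Ls < \<tau>\<^sup>2" .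

  have "\<sigma> i < 1" if "i \<in> {1..min m n}" for i
    using that sigma_s[of "i - 1"] s_lt[of "i - 1"] by auto
  then show ?thesis
    using cE At_eq E_psd E_norm t_le Lt_norm A_Ls Ls_norm unfolding t_def by blast
qed

end
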